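(* There exists a unique ring isomorphism $$\phi:\ \mathcal{H}_{\mathbb{Z}}(\Gamma,\Gamma_0)\xrightarrow{\ \sim\ }\mathcal{A}_{\mathbb{Z}}=\mathbb{Z}[\mathbb{Q}/\mathbb{Z}]\rtimes_{\tilde\rho}\mathbb{N}$$ such that $\phi(e(r))=e(r)$ for all $r\in\mathbb{Q}/\mathbb{Z}$, and $\phi(\nu_n)=\tilde\mu_n$, $\phi(\nu_n^* )=\mu_n^*$ for all $n\in\mathbb{N}$.
   Context: $\mathbb{N}$ is the set of positive integers; $(m,n)$ denotes the gcd. Integral Hecke algebra. Let $\Gamma=P_{\mathbb{Q}}^+=\left\{\begin{pmatrix}1&b\\0&a\end{pmatrix}: a,b\in\mathbb{Q},\ a>0\right\}$ and $\Gamma_0=P_{\mathbb{Z}}^+=\left\{\begin{pmatrix}1&b\\0&1\end{pmatrix}: b\in\mathbb{Z}\right\}$. The orbits of $\Gamma_0$ acting on the left on $\Gamma/\Gamma_0$ and on the right on $\Gamma_0\backslash\Gamma$ are finite. $\mathcal{H}_{\mathbb{Z}}(\Gamma,\Gamma_0)$ is the set of functions $f:\Gamma_0\backslash\Gamma\to\mathbb{Z}$ of finite support with $f(\gamma\gamma_0)=f(\gamma)$ for all $\gamma\in\Gamma,\gamma_0\in\Gamma_0$, with the convolution product $(f_1*f_2)(\gamma)=\sum_{\gamma_1\in\Gamma_0\backslash\Gamma}f_1(\gamma\gamma_1^{-1})f_2(\gamma_1)$. In it, $e(r)$ ($r\in\mathbb{Q}/\mathbb{Z}$) is the indicator function of the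 double coset of $\begin{pmatrix}1&r\\0&1\end{pmatrix}$, $\nu_n$ is the indicator function of the double coset $X_n=\Gamma_0\begin{pmatrix}1&0\\0&n\end{pmatrix}\Gamma_0$, and $\nu_n^*$ is the indicator function of $X_n^{-1}$. The algebra $\mathcal{A}_{\mathbb{Z}}$. $\mathbb{Z}[\mathbb{Q}/\mathbb{Z}]$ is the group ring with canonical basis $e(r)$, $r\in\mathbb{Q}/\mathbb{Z}$. For $n\in\mathbb{N}$, $\sigma_n$ is the ring endomorphism of $\mathbb{Z}[\mathbb{Q}/\mathbb{Z}]$ with $\sigma_n(e(r))=e(nr)$, and $\tilde\rho_n$ is the additive map with $\tilde\rho_n(e(r))=\sum_{ns=r}e(s)$. $\mathcal{A}_{\mathbb{Z}}$ is the (unital, associative) ring generated by the group ring $\mathbb{Z}[\mathbb{Q}/\mathbb{Z}]$ and elements $\tilde\mu_n,\mu_n^*$ ($n\in\mathbb{N}$), subject to the relations (for all $x\in\mathbb{Z}[\mathbb{Q}/\mathbb{Z}]$ and all $n,m\in\mathbb{N}$): $\tilde\mu_n x\mu_n^*=\tilde\rho_n(x)$; $\mu_n^*x=\sigma_n(x)\mu_n^*$; $x\tilde\mu_n=\tilde\mu_n\sigma_n(x)$; $\tilde\mu_{nm}=\tilde\mu_n\tilde\mu_m$; $\mu_{nm}^*=\mu_n^*\mu_m^*$; $\mu_n^*\tilde\mu_n=n$; and $\tilde\mu_n\mu_m^*=\mu_m^*\tilde\mu_n$ whenever $(n,m)=1$. *)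

theory Defs
  imports
    "HOL-Analysis.Cartesian_Space"
    "HOL-Algebra.Coset"
    "HOL-Library.Poly_Mapping"
    "HOL-Library.Indicator_Function"
begin

section \<open>Positive integers and \<open>\<rat>/\<int>\<close>\<close>

typedef pnat = "{n::nat. 0 < n}" morphisms nat_of_pnat pnat_of_nat
  by (rule exI[of _ 1]) simp

setup_lifting type_definition_pnat

instantiation pnat :: comm_monoid_mult
begin

lift_definition one_pnat :: pnat is 1 by simp
lift_definition times_pnat :: "pnat \<Rightarrow> pnat \<Rightarrow> pnat" is "(*)" by simp

instance by intro_classes (transfer; simp add: mult_ac)+

end

lemma nat_of_pnat_pos [simp]: "0 < nat_of_pnat n"
  using nat_of_pnat[of n] by simp

quotient_type qmodz = rat / "\<lambda>x y. x - y \<in> \<int>"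
proof (rule equivpI)
  show "reflp (\<lambda>x y::rat. x - y \<in> \<int>)" by (simp add: reflp_def)
  show "symp (\<lambda>x y::rat. x - y \<in> \<int>)"
    by (metis (mono_tags, lifting) Ints_minus minus_diff_eq sympI)
  show "transp (\<lambda>x y::rat. x - y \<in> \<int>)"
  proof (rule transpI)
    fix x y z :: rat assume "x - y \<in> \<int>" "y - z \<in> \<int>"
    hence "(x - y) + (y - z) \<in> \<int>" by (rule Ints_add)
    thus "x - z \<in> \<int>" by simp
  qed
qed

instantiation qmodz :: ab_group_add
begin

lift_definition zero_qmodz :: qmodz is 0 .

lift_definition plus_qmodz :: "qmodz \<Rightarrow> qmodz \<Rightarrow> qmodz" is "(+)"
  by (metis Ints_add add_diff_add)

lift_definition uminus_qmodz :: "qmodz \<Rightarrow> qmodz" is uminus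
  by (metis Ints_minus minus_diff_minus)

lift_definition minus_qmodz :: "qmodz \<Rightarrow> qmodz \<Rightarrow> qmodz" is "(-)"
proof -
  fix a b c d :: rat assume "a - b \<in> \<int>" "c - d \<in> \<int>"
  hence "(a - b) - (c - d) \<in> \<int>" by (rule Ints_diff)
  thus "a - c - (b - d) \<in> \<int>" by (simp add: algebra_simps)
qed

instance by intro_classes (transfer; simp)+

end

lift_definition qmodz_scale :: "nat \<Rightarrow> qmodz \<Rightarrow> qmodz" is "\<lambda>n r. of_nat n * r"
  by (metis Ints_mult Ints_of_nat right_diff_distrib)

lemma qmodz_scale_add: "qmodz_scale n (r + s) = qmodz_scale n r + qmodz_scale n s"
  by transfer (simp add: algebra_simps)

lemma qmodz_abs_surj: "\<exists>q. r = abs_qmodz q"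
  by (induction r rule: qmodz.abs_induct) blast

text \<open>The map \<^term>\<open>qmodz_scale n\<close> is onto with fibres of size \<open>n\<close>; in particular the sums over
  \<^term>\<open>{s. qmodz_scale n s = r}\<close> below are sums over finite sets.\<close>

lemma qmodz_scale_fibre:
  assumes "0 < n"
  shows "finite {s. qmodz_scale n s = r}" "card {s. qmodz_scale n s = r} = n"
proof -
  obtain q where q: "r = abs_qmodz q" using qmodz_abs_surj by blast
  let ?f = "\<lambda>i::nat. abs_qmodz ((q + of_nat i) / of_nat n)"
  have inj: "inj_on ?f {..<n}"
  proof (rule inj_onI)
    fix i j assume ij: "i \<in> {..<n}" "j \<in> {..<n}" "?f i = ?f j"
    then obtain k where "(q + of_nat i) / of_nat n - (q + of_nat j) / of_nat n = (of_int k :: rat)"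
      by (auto simp: qmodz.abs_eq_iff elim: Ints_cases)
    hence "((of_nat i - of_nat j) / of_nat n :: rat) = of_int k"
      by (simp add: diff_divide_distrib[symmetric])
    hence "(of_nat i - of_nat j :: rat) = of_int k * of_nat n"
      using assms by (simp add: divide_eq_eq)
    hence "(of_int (int i - int j) :: rat) = of_int (k * int n)" by simp
    hence e: "int i - int j = k * int n" by (simp only: of_int_eq_iff)
    have "\<bar>int i - int j\<bar> < int n" using ij by auto
    hence "\<bar>k\<bar> * int n < 1 * int n" using e by (simp add: abs_mult)
    hence "k = 0" using assms by (simp only: mult_less_cancel_right) auto
    thus "i = j" using e by simp
  qed
  have im: "{s. qmodz_scale n s = r} = ?f ` {..<n}"
  proof (intro equalityI subsetI)
    fix s assume "s \<in> {s. qmodz_scale n s = r}"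
    hence s: "qmodz_scale n s = r" by simp
    obtain t where t: "s = abs_qmodz t" using qmodz_abs_surj by blast
    have "abs_qmodz (of_nat n * t) = abs_qmodz q" using s t q by (simp add: qmodz_scale.abs_eq)
    then obtain k where k: "of_nat n * t - q = of_int k" 
      by (auto simp: qmodz.abs_eq_iff elim: Ints_cases)
    define i where "i = nat (k mod int n)"
    have i: "i < n" "int i = k mod int n" using assms by (auto simp: i_def nat_less_iff)
    have kk: "k = int i + int n * (k div int n)" using i by simp
    have "t - (q + of_nat i) / of_nat n = of_int (k div int n)"
    proof -
      have "of_int k = (of_nat i + of_nat n * of_int (k div int n) :: rat)"
        by (subst kk) simp
      hence "of_nat n * t = q + of_nat i + of_nat n * of_int (k div int n)"
        using k by (simp add: algebra_simps)
      thus ?thesis using assms by (simp add: field_simps)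
    qed
    hence "s = ?f i" using t by (simp add: qmodz.abs_eq_iff)
    thus "s \<in> ?f ` {..<n}" using i by auto
  next
    fix s assume "s \<in> ?f ` {..<n}"
    then obtain i where "s = ?f i" by auto
    thus "s \<in> {s. qmodz_scale n s = r}"
      using assms by (simp add: qmodz_scale.abs_eq q qmodz.abs_eq_iff)
  qed
  show "finite {s. qmodz_scale n s = r}" "card {s. qmodz_scale n s = r} = n"
    using inj im by (simp_all add: card_image)
qed


section \<open>The group ring \<open>\<int>[\<rat>/\<int>]\<close> and the maps \<open>\<sigma>\<^sub>n\<close>, \<open>\<rho>\<^sub>n\<close>\<close>

text \<open>The product of \<^typ>\<open>qmodz \<Rightarrow>\<^sub>0 int\<close> is convolution, and \<open>e(r)\<close> is
  \<^term>\<open>frag_of (r::qmodz)\<close>.\<close>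

type_synonym group_ring = "qmodz \<Rightarrow>\<^sub>0 int"

definition sigma :: "pnat \<Rightarrow> group_ring \<Rightarrow> group_ring" where
  "sigma n = frag_extend (\<lambda>r. frag_of (qmodz_scale (nat_of_pnat n) r))"

definition rho :: "pnat \<Rightarrow> group_ring \<Rightarrow> group_ring" where
  "rho n = frag_extend (\<lambda>r. \<Sum>s | qmodz_scale (nat_of_pnat n) s = r. frag_of s)"

lemma sigma_frag_of: "sigma n (frag_of r) = frag_of (qmodz_scale (nat_of_pnat n) r)"
  by (simp add: sigma_def)

lemma rho_frag_of:
  "rho n (frag_of r) = (\<Sum>s | qmodz_scale (nat_of_pnat n) s = r. frag_of s)"
  by (simp add: rho_def)

lemma sigma_add: "sigma n (x + y) = sigma n x + sigma n y"
  by (simp add: sigma_def frag_extend_add)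

lemma rho_add: "rho n (x + y) = rho n x + rho n y"
  by (simp add: rho_def frag_extend_add)

lemma frag_of_mult: "frag_of (r::'a::monoid_add) * frag_of s = frag_of (r + s)"
  by (simp add: mult_single)

lemma frag_induct [case_names zero single diff]:
  assumes "P 0" "\<And>a. P (frag_of a)" "\<And>a b. P a \<Longrightarrow> P b \<Longrightarrow> P (a - b)"
  shows "P (x :: 'a \<Rightarrow>\<^sub>0 int)"
  by (rule frag_induction[where S = UNIV and P = P]) (use assms in auto)

lemma sigma_mult: "sigma n (x * y) = sigma n x * sigma n y"
proof (induction x rule: frag_induct)
  case zero show ?case by (simp add: sigma_def)
next
  case (diff a b)
  then show ?case by (simp add: sigma_def left_diff_distrib frag_extend_diff)
next
  case (single a)
  show ?case
  proof (induction y rule: frag_induct)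
    case zero show ?case by (simp add: sigma_def)
  next
    case (diff b c)
    then show ?case by (simp add: sigma_def right_diff_distrib frag_extend_diff)
  next
    case (single b)
    show ?case by (simp only: frag_of_mult sigma_frag_of qmodz_scale_add)
  qed
qed

lemma sigma_one: "sigma n 1 = 1"
proof -
  have "qmodz_scale k 0 = 0" for k by transfer simp
  thus ?thesis using sigma_frag_of[of n 0] by simp
qed


section \<open>Free rings and ideals\<close>

text \<open>A free monoid is written additively, because the convolution product of
  \<^typ>\<open>'a \<Rightarrow>\<^sub>0 int\<close> is taken with respect to the operation \<^term>\<open>(+)\<close> on \<^typ>\<open>'a\<close>.  Thus
  \<^term>\<open>0\<close> is the empty word and \<^term>\<open>(+)\<close> is concatenation, and
  \<open>'g free_monoid \<Rightarrow>\<^sub>0 int\<close> is the free associative unital ring on \<open>'g\<close>.\<close>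

datatype 'g free_monoid = Letters (letters: "'g list")

instantiation free_monoid :: (type) monoid_add
begin

definition zero_free_monoid :: "'a free_monoid" where "zero_free_monoid = Letters []"

definition plus_free_monoid :: "'a free_monoid \<Rightarrow> 'a free_monoid \<Rightarrow> 'a free_monoid" where
  "plus_free_monoid v w = Letters (letters v @ letters w)"

instance by intro_classes (simp_all add: zero_free_monoid_def plus_free_monoid_def)

end

type_synonym 'g free_ring = "'g free_monoid \<Rightarrow>\<^sub>0 int"

definition gen :: "'g \<Rightarrow> 'g free_ring" where
  "gen g = frag_of (Letters [g])"

definition two_sided_ideal :: "'a::ring set \<Rightarrow> bool" where
  "two_sided_ideal I \<longleftrightarrow>
     0 \<in> I \<and> (\<forall>x\<in>I. \<forall>y\<in>I. x - y \<in> I) \<and> (\<forall>x\<in>I. \<forall>r. r * x \<in> I \<and> x * r \<in> I)"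

definition ideal_generated :: "'a::ring set \<Rightarrow> 'a set" where
  "ideal_generated S = \<Inter>{I. two_sided_ideal I \<and> S \<subseteq> I}"

lemma ideal_generated: "two_sided_ideal (ideal_generated S)" "S \<subseteq> ideal_generated S"
  by (auto simp: ideal_generated_def two_sided_ideal_def)

lemma ideal_generated_least: "two_sided_ideal I \<Longrightarrow> S \<subseteq> I \<Longrightarrow> ideal_generated S \<subseteq> I"
  by (auto simp: ideal_generated_def)

definition free_eval :: "('g \<Rightarrow> 'b::ring_1) \<Rightarrow> 'g free_ring \<Rightarrow> 'b" where
  "free_eval v x = (\<Sum>w\<in>Poly_Mapping.keys x.
     of_int (Poly_Mapping.lookup x w) * prod_list (map v (letters w)))"

lemma free_eval_superset:
  assumes "finite A" "Poly_Mapping.keys x \<subseteq> A"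
  shows "free_eval v x =
    (\<Sum>w\<in>A. of_int (Poly_Mapping.lookup x w) * prod_list (map v (letters w)))"
  unfolding free_eval_def
  by (rule sum.mono_neutral_left) (use assms in \<open>auto simp: in_keys_iff\<close>)

lemma free_eval_add: "free_eval v (x + y) = free_eval v x + free_eval v y"
proof -
  let ?A = "Poly_Mapping.keys x \<union> Poly_Mapping.keys y"
  have k: "Poly_Mapping.keys (x + y) \<subseteq> ?A" by (rule Poly_Mapping.keys_add)
  show ?thesis
    by (simp add: free_eval_superset[of ?A] k lookup_add algebra_simps sum.distrib)
qed

lemma free_eval_zero: "free_eval v 0 = 0"
  by (simp add: free_eval_def)

lemma free_eval_minus: "free_eval v (- x) = - free_eval v x"
  using free_eval_add[of v x "- x"] by (simp add: free_eval_zero add_eq_0_iff)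

lemma free_eval_diff: "free_eval v (x - y) = free_eval v x - free_eval v y"
  using free_eval_add[of v x "- y"] by (simp add: free_eval_minus)

lemma free_eval_frag_of: "free_eval v (frag_of w) = prod_list (map v (letters w))"
  by (simp add: free_eval_def)

lemma free_eval_gen: "free_eval v (gen g) = v g"
  by (simp add: gen_def free_eval_frag_of)

lemma free_eval_one:
  fixes v :: "'g \<Rightarrow> 'b::ring_1"
  shows "free_eval v 1 = 1"
proof -
  have "letters (0 :: 'g free_monoid) = []" by (simp add: zero_free_monoid_def)
  thus ?thesis using free_eval_frag_of[of v 0] by simp
qed

lemma free_eval_mult: "free_eval v (x * y) = free_eval v x * free_eval v y"
proof (induction x rule: frag_induct)
  case zero show ?case by (simp add: free_eval_zero)
next
  case (diff a b)
  then show ?case by (simp add: left_diff_distrib free_eval_diff)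
next
  case (single a)
  show ?case
  proof (induction y rule: frag_induct)
    case zero show ?case by (simp add: free_eval_zero)
  next
    case (diff b c)
    then show ?case by (simp add: right_diff_distrib free_eval_diff)
  next
    case (single b)
    show ?case
      by (simp only: frag_of_mult free_eval_frag_of plus_free_monoid_def free_monoid.sel
          map_append prod_list.append)
  qed
qed

lemma free_eval_of_nat: "free_eval v (of_nat n) = of_nat n"
  by (induction n) (simp_all add: free_eval_zero free_eval_one free_eval_add)

lemma free_eval_kernel: "two_sided_ideal {x. free_eval v x = 0}"
  by (auto simp: two_sided_ideal_def free_eval_zero free_eval_diff free_eval_mult)


section \<open>The ring \<open>\<A>\<^sub>\<int>\<close>\<close>

datatype bc_gen = E group_ring | Mu pnat | MuStar pnat

text \<open>The first three families make \<open>x \<mapsto> gen (E x)\<close> a unital ring homomorphism modulo the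
  relations.\<close>

inductive_set bc_relators :: "bc_gen free_ring set" where
  E_one: "gen (E 1) - 1 \<in> bc_relators"
| E_add: "gen (E (x + y)) - (gen (E x) + gen (E y)) \<in> bc_relators"
| E_mult: "gen (E (x * y)) - gen (E x) * gen (E y) \<in> bc_relators"
| Mu_E_MuStar: "gen (Mu n) * gen (E x) * gen (MuStar n) - gen (E (rho n x)) \<in> bc_relators"
| MuStar_E: "gen (MuStar n) * gen (E x) - gen (E (sigma n x)) * gen (MuStar n) \<in> bc_relators"
| E_Mu: "gen (E x) * gen (Mu n) - gen (Mu n) * gen (E (sigma n x)) \<in> bc_relators"
| Mu_mult: "gen (Mu (n * m)) - gen (Mu n) * gen (Mu m) \<in> bc_relators"
| MuStar_mult: "gen (MuStar (n * m)) - gen (MuStar n) * gen (MuStar m) \<in> bc_relators"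
| MuStar_Mu: "gen (MuStar n) * gen (Mu n) - of_nat (nat_of_pnat n) \<in> bc_relators"
| Mu_MuStar: "coprime (nat_of_pnat n) (nat_of_pnat m) \<Longrightarrow>
    gen (Mu n) * gen (MuStar m) - gen (MuStar m) * gen (Mu n) \<in> bc_relators"

lemma bc_ideal_zero: "0 \<in> ideal_generated bc_relators"
  and bc_ideal_diff: "x \<in> ideal_generated bc_relators \<Longrightarrow> y \<in> ideal_generated bc_relators
    \<Longrightarrow> x - y \<in> ideal_generated bc_relators"
  and bc_ideal_mult_left: "x \<in> ideal_generated bc_relators \<Longrightarrow> r * x \<in> ideal_generated bc_relators"
  and bc_ideal_mult_right: "x \<in> ideal_generated bc_relators \<Longrightarrow> x * r \<in> ideal_generated bc_relators"
  using ideal_generated(1)[of bc_relators] by (auto simp: two_sided_ideal_def)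

lemma bc_ideal_minus:
  "x \<in> ideal_generated bc_relators \<Longrightarrow> - x \<in> ideal_generated bc_relators"
  using bc_ideal_diff[OF bc_ideal_zero] by fastforce

lemma bc_ideal_add: "x \<in> ideal_generated bc_relators \<Longrightarrow> y \<in> ideal_generated bc_relators
    \<Longrightarrow> x + y \<in> ideal_generated bc_relators"
  using bc_ideal_diff[OF _ bc_ideal_minus] by fastforce

quotient_type bc_ring = "bc_gen free_ring" / "\<lambda>x y. x - y \<in> ideal_generated bc_relators"
proof (rule equivpI)
  show "reflp (\<lambda>x y. x - y \<in> ideal_generated bc_relators)"
    by (simp add: reflp_def bc_ideal_zero)
  show "symp (\<lambda>x y. x - y \<in> ideal_generated bc_relators)"
    by (metis (mono_tags, lifting) bc_ideal_minus minus_diff_eq sympI)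
  show "transp (\<lambda>x y. x - y \<in> ideal_generated bc_relators)"
  proof (rule transpI)
    fix x y z :: "bc_gen free_ring"
    assume "x - y \<in> ideal_generated bc_relators" "y - z \<in> ideal_generated bc_relators"
    hence "(x - y) + (y - z) \<in> ideal_generated bc_relators" by (rule bc_ideal_add)
    thus "x - z \<in> ideal_generated bc_relators" by simp
  qed
qed

text \<open>The trivial representation \<open>e(r) \<mapsto> 1\<close>, \<open>\<mu>\<^sub>n \<mapsto> n\<close>, \<open>\<mu>\<^sub>n\<^sup>* \<mapsto> 1\<close> in \<open>\<int>\<close> shows that the
  quotient is not the zero ring.\<close>

definition bc_triv :: "bc_gen \<Rightarrow> int" where
  "bc_triv g = (case g of
      E x \<Rightarrow> (\<Sum>r\<in>Poly_Mapping.keys x. Poly_Mapping.lookup x r)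
    | Mu n \<Rightarrow> int (nat_of_pnat n)
    | MuStar n \<Rightarrow> 1)"

lemma one_notin_bc_ideal: "1 \<notin> ideal_generated bc_relators"
proof
  define aug where "aug x = (\<Sum>r\<in>Poly_Mapping.keys x. Poly_Mapping.lookup x r)"
    for x :: group_ring
  have aug_sup: "aug x = sum (Poly_Mapping.lookup x) A"
    if "finite A" "Poly_Mapping.keys x \<subseteq> A" for x A
    unfolding aug_def by (rule sum.mono_neutral_left) (use that in \<open>auto simp: in_keys_iff\<close>)
  have aug_add: "aug (x + y) = aug x + aug y" for x y
    using Poly_Mapping.keys_add[of x y]
    by (simp add: aug_sup[of "Poly_Mapping.keys x \<union> Poly_Mapping.keys y"] lookup_add sum.distrib)
  have aug_0: "aug 0 = 0" by (simp add: aug_def)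
  have aug_diff: "aug (x - y) = aug x - aug y" for x y
    using aug_add[of "x - y" y] by simp
  have aug_of: "aug (frag_of r) = 1" for r by (simp add: aug_def)
  have aug_sum: "aug (sum f A) = (\<Sum>i\<in>A. aug (f i))" for f :: "qmodz \<Rightarrow> group_ring" and A
    by (induction A rule: infinite_finite_induct) (simp_all add: aug_0 aug_add)
  have aug_mult: "aug (x * y) = aug x * aug y" for x y
  proof (induction x rule: frag_induct)
    case (single a)
    show ?case
      by (induction y rule: frag_induct)
        (simp_all only: aug_0 aug_diff aug_of frag_of_mult right_diff_distrib mult_zero_right
          mult_1_left)
  qed (simp_all add: aug_0 aug_diff left_diff_distrib)
  have aug_1: "aug 1 = 1" using aug_of[of 0] by simp
  have aug_sigma: "aug (sigma n x) = aug x" for n x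
    by (induction x rule: frag_induct)
      (simp_all only: sigma_frag_of aug_of, simp_all add: sigma_def frag_extend_diff aug_diff)
  have aug_rho: "aug (rho n x) = int (nat_of_pnat n) * aug x" for n x
    by (induction x rule: frag_induct)
      (simp_all only: rho_frag_of aug_of aug_sum,
        simp_all add: rho_def frag_extend_diff aug_diff aug_0 qmodz_scale_fibre right_diff_distrib)
  have v: "bc_triv (E x) = aug x" "bc_triv (Mu n) = int (nat_of_pnat n)" "bc_triv (MuStar n) = 1"
    for x n by (simp_all add: bc_triv_def aug_def)
  have "bc_relators \<subseteq> {x. free_eval bc_triv x = 0}"
  proof
    fix x assume "x \<in> bc_relators"
    thus "x \<in> {x. free_eval bc_triv x = 0}"
      by induction (simp_all add: free_eval_diff free_eval_mult free_eval_add free_eval_gen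
          free_eval_one free_eval_of_nat v aug_1 aug_add aug_mult aug_rho aug_sigma
          times_pnat.rep_eq)
  qed
  hence *: "ideal_generated bc_relators \<subseteq> {x. free_eval bc_triv x = 0}"
    by (rule ideal_generated_least[OF free_eval_kernel])
  assume "1 \<in> ideal_generated bc_relators"
  with * have "free_eval bc_triv 1 = 0" by blast
  thus False by (simp add: free_eval_one)
qed

instantiation bc_ring :: ring_1
begin

lift_definition zero_bc_ring :: bc_ring is 0 .

lift_definition one_bc_ring :: bc_ring is 1 .

lift_definition plus_bc_ring :: "bc_ring \<Rightarrow> bc_ring \<Rightarrow> bc_ring" is "(+)"
  by (metis bc_ideal_add add_diff_add)

lift_definition uminus_bc_ring :: "bc_ring \<Rightarrow> bc_ring" is uminus
  by (metis bc_ideal_minus minus_diff_minus)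

lift_definition minus_bc_ring :: "bc_ring \<Rightarrow> bc_ring \<Rightarrow> bc_ring" is "(-)"
proof -
  fix a b c d :: "bc_gen free_ring"
  assume "a - b \<in> ideal_generated bc_relators" "c - d \<in> ideal_generated bc_relators"
  hence "(a - b) - (c - d) \<in> ideal_generated bc_relators" by (rule bc_ideal_diff)
  thus "a - c - (b - d) \<in> ideal_generated bc_relators" by (simp add: algebra_simps)
qed

lift_definition times_bc_ring :: "bc_ring \<Rightarrow> bc_ring \<Rightarrow> bc_ring" is "(*)"
proof -
  fix a b c d :: "bc_gen free_ring"
  assume "a - b \<in> ideal_generated bc_relators" "c - d \<in> ideal_generated bc_relators"
  hence "(a - b) * c + b * (c - d) \<in> ideal_generated bc_relators"
    by (intro bc_ideal_add bc_ideal_mult_left bc_ideal_mult_right)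
  thus "a * c - b * d \<in> ideal_generated bc_relators" by (simp add: algebra_simps)
qed

instance
proof
  show "(0::bc_ring) \<noteq> 1"
    using one_notin_bc_ideal bc_ideal_minus[of "- 1"] by transfer auto
qed (transfer; simp add: algebra_simps bc_ideal_zero)+

end

lift_definition bc_emb :: "group_ring \<Rightarrow> bc_ring" is "\<lambda>x. gen (E x)" .

definition bc_e :: "qmodz \<Rightarrow> bc_ring" where
  "bc_e r = bc_emb (frag_of r)"

lift_definition bc_mu :: "pnat \<Rightarrow> bc_ring" is "\<lambda>n. gen (Mu n)" .

lift_definition bc_mu_star :: "pnat \<Rightarrow> bc_ring" is "\<lambda>n. gen (MuStar n)" .


section \<open>Hecke algebras with integer coefficients\<close>

text \<open>A function on \<open>H \ G\<close> is represented by a left \<open>H\<close>-invariant function on \<open>G\<close>, extended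
  by \<open>0\<close> to the whole type.  In \<open>HOL-Algebra\<close>, \<open>rcosets\<^bsub>G\<^esub> H\<close> is the set of all
  \<open>H #>\<^bsub>G\<^esub> x = H x\<close>, that is \<open>H \ G\<close>.\<close>

definition coset_support :: "('a, 'c) monoid_scheme \<Rightarrow> 'a set \<Rightarrow> ('a \<Rightarrow> int) \<Rightarrow> 'a set set" where
  "coset_support G H F = {C \<in> rcosets\<^bsub>G\<^esub> H. \<exists>x\<in>C. F x \<noteq> 0}"

definition hecke_funs :: "('a, 'c) monoid_scheme \<Rightarrow> 'a set \<Rightarrow> ('a \<Rightarrow> int) set" where
  "hecke_funs G H = {f.
     (\<forall>x. x \<notin> carrier G \<longrightarrow> f x = 0) \<and>
     (\<forall>h\<in>H. \<forall>x\<in>carrier G. f (h \<otimes>\<^bsub>G\<^esub> x) = f x) \<and>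
     (\<forall>h\<in>H. \<forall>x\<in>carrier G. f (x \<otimes>\<^bsub>G\<^esub> h) = f x) \<and>
     finite (coset_support G H f)}"

text \<open>For left \<open>H\<close>-invariant \<open>F\<close> of finite support, this is \<open>\<Sum>\<^bsub>x \<in> H \ G\<^esub> F x\<close>; the chosen
  representative is irrelevant.\<close>

definition coset_sum :: "('a, 'c) monoid_scheme \<Rightarrow> 'a set \<Rightarrow> ('a \<Rightarrow> int) \<Rightarrow> int" where
  "coset_sum G H F = (\<Sum>C\<in>coset_support G H F. F (SOME x. x \<in> C))"

definition hecke_conv ::
  "('a, 'c) monoid_scheme \<Rightarrow> 'a set \<Rightarrow> ('a \<Rightarrow> int) \<Rightarrow> ('a \<Rightarrow> int) \<Rightarrow> 'a \<Rightarrow> int" where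
  "hecke_conv G H f1 f2 x =
     (if x \<in> carrier G then coset_sum G H (\<lambda>y. f1 (x \<otimes>\<^bsub>G\<^esub> inv\<^bsub>G\<^esub> y) * f2 y) else 0)"

definition double_coset :: "('a, 'c) monoid_scheme \<Rightarrow> 'a set \<Rightarrow> 'a \<Rightarrow> 'a set" where
  "double_coset G H g = (H #>\<^bsub>G\<^esub> g) <#>\<^bsub>G\<^esub> H"

locale group_with_subgroup = group G + sg?: subgroup H G
  for G :: "('a, 'c) monoid_scheme" (structure) and H
begin

definition linv :: "('a \<Rightarrow> int) \<Rightarrow> bool" where
  "linv F \<longleftrightarrow> (\<forall>h\<in>H. \<forall>x\<in>carrier G. F (h \<otimes> x) = F x)"

abbreviation rep :: "'a set \<Rightarrow> 'a" where "rep C \<equiv> SOME x. x \<in> C"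

lemma rcosetD:
  assumes "C \<in> rcosets H"
  shows "C \<subseteq> carrier G" "rep C \<in> C" "rep C \<in> carrier G" "\<And>x. x \<in> C \<Longrightarrow> C = H #> x"
proof -
  show sub: "C \<subseteq> carrier G" by (rule rcosets_carrier[OF is_group assms])
  have "C \<noteq> {}" using rcosets_non_empty[OF assms] .
  thus r: "rep C \<in> C" by (simp add: some_in_eq)
  thus "rep C \<in> carrier G" using sub by blast
  show "C = H #> x" if "x \<in> C" for x
  proof -
    obtain a where a: "a \<in> carrier G" "C = H #> a" using assms by (auto simp: RCOSETS_def)
    show ?thesis using that a repr_independence[of x H a] subgroup_axioms by simp
  qed
qed

lemma mem_rcoset_self: "x \<in> carrier G \<Longrightarrow> x \<in> H #> x" "x \<in> carrier G \<Longrightarrow> H #> x \<in> rcosets H"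
  using rcos_self[OF _ subgroup_axioms] rcosetsI[OF subset] by auto

lemma linv_const:
  assumes "linv F" "C \<in> rcosets H" "x \<in> C" "y \<in> C"
  shows "F x = F y"
proof -
  have C: "C = H #> y" "y \<in> carrier G" using assms(2,4) rcosetD by blast+
  then obtain h where "h \<in> H" "x = h \<otimes> y" using assms(3) by (auto simp: r_coset_def)
  thus ?thesis using assms(1) C by (simp add: linv_def)
qed

lemma coset_sum_superset:
  assumes "finite A" "coset_support G H F \<subseteq> A" "A \<subseteq> rcosets H"
  shows "coset_sum G H F = (\<Sum>C\<in>A. F (rep C))"
  unfolding coset_sum_def
proof (rule sum.mono_neutral_left)
  show "\<forall>C\<in>A - coset_support G H F. F (rep C) = 0"
    using assms(3) rcosetD(2) by (auto simp: coset_support_def)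
qed (use assms in auto)

lemma coset_support_subset: "coset_support G H F \<subseteq> rcosets H"
  by (auto simp: coset_support_def)

lemma coset_sum_cong:
  assumes "\<And>x. x \<in> carrier G \<Longrightarrow> F x = F' x"
  shows "coset_sum G H F = coset_sum G H F'"
proof -
  have "coset_support G H F = coset_support G H F'"
    using rcosetD(1) assms by (auto simp: coset_support_def subset_iff)
  thus ?thesis unfolding coset_sum_def
    using assms rcosetD(3) coset_support_subset by (intro sum.cong) blast+
qed

lemma shift_coset:
  assumes "C \<in> rcosets H" "g \<in> carrier G"
  shows "C #> g \<in> rcosets H" "(C #> g) #> inv g = C" "(C #> inv g) #> g = C"
    "x \<in> C \<Longrightarrow> x \<otimes> g \<in> C #> g"
proof -
  note C = rcosetD[OF assms(1)]
  show "C #> g \<in> rcosets H"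
    using C(3) C(4)[OF C(2)] assms(2) mem_rcoset_self(2)[of "rep C \<otimes> g"]
      coset_mult_assoc[OF subset, of "rep C" g] by simp
  show "(C #> g) #> inv g = C" "(C #> inv g) #> g = C"
    using assms C(1) by (simp_all add: coset_mult_assoc)
  show "x \<otimes> g \<in> C #> g" if "x \<in> C" using that by (auto simp: r_coset_def)
qed

lemma shift_support:
  assumes "g \<in> carrier G" "C \<in> coset_support G H (\<lambda>y. F (y \<otimes> g))"
  shows "C #> g \<in> coset_support G H F"
proof -
  obtain x where x: "C \<in> rcosets H" "x \<in> C" "F (x \<otimes> g) \<noteq> 0"
    using assms(2) by (auto simp: coset_support_def)
  show ?thesis
    using x(3) shift_coset(1)[OF x(1) assms(1)] shift_coset(4)[OF x(1) assms(1) x(2)]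
    by (auto simp: coset_support_def)
qed

lemma finite_shift_support:
  assumes "g \<in> carrier G" "finite (coset_support G H F)"
  shows "finite (coset_support G H (\<lambda>y. F (y \<otimes> g)))"
proof (rule finite_subset)
  show "coset_support G H (\<lambda>y. F (y \<otimes> g)) \<subseteq> (\<lambda>C. C #> inv g) ` coset_support G H F"
  proof
    fix C assume C: "C \<in> coset_support G H (\<lambda>y. F (y \<otimes> g))"
    hence "C = (C #> g) #> inv g" using assms(1) coset_support_subset shift_coset(2) by blast
    thus "C \<in> (\<lambda>C. C #> inv g) ` coset_support G H F" using shift_support[OF assms(1) C] by blast
  qed
qed (use assms in auto)

lemma coset_sum_shift:
  assumes "g \<in> carrier G" "linv F"
  shows "coset_sum G H (\<lambda>y. F (y \<otimes> g)) = coset_sum G H F"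
  unfolding coset_sum_def
proof (rule sum.reindex_bij_witness[where j = "\<lambda>C. C #> g" and i = "\<lambda>C. C #> inv g"])
  fix C assume C: "C \<in> coset_support G H (\<lambda>y. F (y \<otimes> g))"
  hence C': "C \<in> rcosets H" using coset_support_subset by blast
  show "(C #> g) #> inv g = C" by (rule shift_coset[OF C' assms(1)])
  show "C #> g \<in> coset_support G H F" by (rule shift_support[OF assms(1) C])
  show "F (rep (C #> g)) = F (rep C \<otimes> g)"
    by (rule linv_const[OF assms(2) shift_coset(1)[OF C' assms(1)]])
      (use shift_coset[OF C' assms(1)] rcosetD C' in blast)+
next
  fix C assume C: "C \<in> coset_support G H F"
  hence C': "C \<in> rcosets H" using coset_support_subset by blast
  show "(C #> inv g) #> g = C" by (rule shift_coset[OF C' assms(1)])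
  have "C \<in> coset_support G H (\<lambda>y. F ((y \<otimes> g) \<otimes> inv g))"
  proof -
    have "F ((y \<otimes> g) \<otimes> inv g) = F y" if "y \<in> C" for y
      using that rcosetD(1)[OF C'] assms(1) by (auto simp: m_assoc subset_iff)
    thus ?thesis using C by (auto simp: coset_support_def)
  qed
  then obtain y where y: "y \<in> C" "F y \<noteq> 0" using C by (auto simp: coset_support_def)
  have yc: "y \<in> carrier G" using y rcosetD(1)[OF C'] by blast
  have "y \<otimes> inv g \<in> C #> inv g" using shift_coset(4)[OF C'] y assms(1) by simp
  moreover have "F ((y \<otimes> inv g) \<otimes> g) \<noteq> 0" using y yc assms(1) by (simp add: m_assoc)
  ultimately show "C #> inv g \<in> coset_support G H (\<lambda>y. F (y \<otimes> g))"
    using shift_coset(1)[OF C'] assms(1) by (auto simp: coset_support_def)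
qed

lemma hecke_funsD:
  assumes "f \<in> hecke_funs G H"
  shows "x \<notin> carrier G \<Longrightarrow> f x = 0" "h \<in> H \<Longrightarrow> x \<in> carrier G \<Longrightarrow> f (h \<otimes> x) = f x"
    "h \<in> H \<Longrightarrow> x \<in> carrier G \<Longrightarrow> f (x \<otimes> h) = f x" "finite (coset_support G H f)" "linv f"
  using assms by (auto simp: hecke_funs_def linv_def)

lemma conv_linv:
  assumes "f1 \<in> hecke_funs G H" "f2 \<in> hecke_funs G H" "x \<in> carrier G"
  shows "linv (\<lambda>y. f1 (x \<otimes> inv y) * f2 y)"
  unfolding linv_def
proof (intro ballI)
  fix h y assume h: "h \<in> H" and y: "y \<in> carrier G"
  have "x \<otimes> inv (h \<otimes> y) = (x \<otimes> inv y) \<otimes> inv h"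
    using h y assms(3) by (simp add: inv_mult_group m_assoc)
  hence "f1 (x \<otimes> inv (h \<otimes> y)) = f1 (x \<otimes> inv y)"
    using hecke_funsD(3)[OF assms(1)] h y assms(3) by simp
  thus "f1 (x \<otimes> inv (h \<otimes> y)) * f2 (h \<otimes> y) = f1 (x \<otimes> inv y) * f2 y"
    using hecke_funsD(2)[OF assms(2)] h y by simp
qed

lemma conv_eq:
  assumes "x \<in> carrier G" "finite A" "coset_support G H f2 \<subseteq> A" "A \<subseteq> rcosets H"
  shows "hecke_conv G H f1 f2 x = (\<Sum>C\<in>A. f1 (x \<otimes> inv (rep C)) * f2 (rep C))"
proof -
  have "coset_support G H (\<lambda>y. f1 (x \<otimes> inv y) * f2 y) \<subseteq> A"
    using assms(3) by (auto simp: coset_support_def)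
  thus ?thesis using assms by (simp add: hecke_conv_def coset_sum_superset)
qed

lemma conv_closed:
  assumes f1: "f1 \<in> hecke_funs G H" and f2: "f2 \<in> hecke_funs G H"
  shows "hecke_conv G H f1 f2 \<in> hecke_funs G H"
proof -
  have 1: "hecke_conv G H f1 f2 (h \<otimes> x) = hecke_conv G H f1 f2 x"
    if h: "h \<in> H" and x: "x \<in> carrier G" for h x
  proof -
    have "f1 (h \<otimes> x \<otimes> inv y) = f1 (x \<otimes> inv y)" if "y \<in> carrier G" for y
      using hecke_funsD(2)[OF f1 h, of "x \<otimes> inv y"] h x that by (simp add: m_assoc)
    thus ?thesis using h x by (simp add: hecke_conv_def cong: coset_sum_cong)
  qed
  have 2: "hecke_conv G H f1 f2 (x \<otimes> h) = hecke_conv G H f1 f2 x"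
    if h: "h \<in> H" and x: "x \<in> carrier G" for h x
  proof -
    have hc: "h \<in> carrier G" using h by simp
    have "coset_sum G H (\<lambda>y. f1 (x \<otimes> h \<otimes> inv y) * f2 y) =
      coset_sum G H (\<lambda>y. f1 (x \<otimes> h \<otimes> inv (y \<otimes> h)) * f2 (y \<otimes> h))"
      using coset_sum_shift[OF hc conv_linv[OF f1 f2, of "x \<otimes> h"]] x h by simp
    also have "\<dots> = coset_sum G H (\<lambda>y. f1 (x \<otimes> inv y) * f2 y)"
    proof (rule coset_sum_cong)
      fix y assume y: "y \<in> carrier G"
      have "h \<otimes> (inv h \<otimes> inv y) = inv y" using hc y by (simp add: m_assoc[symmetric])
      hence "x \<otimes> h \<otimes> inv (y \<otimes> h) = x \<otimes> inv y"
        using x y hc by (simp add: inv_mult_group m_assoc)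
      thus "f1 (x \<otimes> h \<otimes> inv (y \<otimes> h)) * f2 (y \<otimes> h) = f1 (x \<otimes> inv y) * f2 y"
        using hecke_funsD(3)[OF f2 h y] by simp
    qed
    finally show ?thesis using x h by (simp add: hecke_conv_def)
  qed
  have "coset_support G H (hecke_conv G H f1 f2) \<subseteq>
    (\<lambda>(C, D). H #> (rep C \<otimes> rep D)) ` (coset_support G H f1 \<times> coset_support G H f2)"
  proof
    fix E assume "E \<in> coset_support G H (hecke_conv G H f1 f2)"
    then obtain x where E: "E \<in> rcosets H" "x \<in> E" "hecke_conv G H f1 f2 x \<noteq> 0"
      by (auto simp: coset_support_def)
    have x: "x \<in> carrier G" "E = H #> x" using E rcosetD by blast+
    have "(\<Sum>D\<in>coset_support G H f2. f1 (x \<otimes> inv (rep D)) * f2 (rep D)) \<noteq> 0"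
      using E(3) conv_eq[OF x(1) hecke_funsD(4)[OF f2] order_refl coset_support_subset, of f1]
      by simp
    then obtain D where D: "D \<in> coset_support G H f2" "f1 (x \<otimes> inv (rep D)) \<noteq> 0"
      by (metis (no_types, lifting) mult_zero_left sum.neutral)
    have d: "rep D \<in> carrier G" using D(1) coset_support_subset rcosetD(3) by blast
    define C where "C = H #> (x \<otimes> inv (rep D))"
    have C: "C \<in> rcosets H" "x \<otimes> inv (rep D) \<in> C"
      using mem_rcoset_self[of "x \<otimes> inv (rep D)"] x d by (auto simp: C_def)
    hence CS: "C \<in> coset_support G H f1" using D(2) by (auto simp: coset_support_def)
    have "rep C \<in> C" using rcosetD C by blast
    then obtain h where h: "h \<in> H" "rep C = h \<otimes> (x \<otimes> inv (rep D))"
      by (auto simp: C_def r_coset_def)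
    have "rep C \<otimes> rep D = h \<otimes> x" using h x d by (simp add: m_assoc)
    moreover have "H #> (h \<otimes> x) = H #> x"
      using h x(1) coset_mult_assoc[OF subset, of h x] coset_join2[OF _ subgroup_axioms, of h]
      by simp
    ultimately have "E = (\<lambda>(C, D). H #> (rep C \<otimes> rep D)) (C, D)" using x by simp
    thus "E \<in> (\<lambda>(C, D). H #> (rep C \<otimes> rep D)) ` (coset_support G H f1 \<times> coset_support G H f2)"
      using CS D(1) by blast
  qed
  hence "finite (coset_support G H (hecke_conv G H f1 f2))"
    using hecke_funsD(4)[OF f1] hecke_funsD(4)[OF f2] by (auto intro: finite_subset)
  thus ?thesis using 1 2 by (simp add: hecke_funs_def) (simp add: hecke_conv_def)
qed

lemma conv_assoc:
  assumes f1: "f1 \<in> hecke_funs G H" and f2: "f2 \<in> hecke_funs G H" and f3: "f3 \<in> hecke_funs G H"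
  shows "hecke_conv G H (hecke_conv G H f1 f2) f3 = hecke_conv G H f1 (hecke_conv G H f2 f3)"
proof
  fix x
  show "hecke_conv G H (hecke_conv G H f1 f2) f3 x = hecke_conv G H f1 (hecke_conv G H f2 f3) x"
  proof (cases "x \<in> carrier G")
    case False thus ?thesis by (simp add: hecke_conv_def)
  next
    case x: True
    define A where "A = coset_support G H f3"
    have A: "finite A" "coset_support G H f3 \<subseteq> A" "A \<subseteq> rcosets H"
      using hecke_funsD(4)[OF f3] coset_support_subset by (auto simp: A_def)
    have d: "rep D \<in> carrier G" if "D \<in> A" for D using that A(3) rcosetD(3) by blast
    define B where "B = coset_support G H (hecke_conv G H f2 f3) \<union>
      (\<Union>D\<in>A. coset_support G H (\<lambda>y. f2 (y \<otimes> inv (rep D))))"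
    have B: "finite B" "B \<subseteq> rcosets H" "coset_support G H (hecke_conv G H f2 f3) \<subseteq> B"
      using A(1) d hecke_funsD(4)[OF conv_closed[OF f2 f3]]
        finite_shift_support[OF _ hecke_funsD(4)[OF f2]] coset_support_subset
      by (auto simp: B_def)
    have inner: "hecke_conv G H f1 f2 (x \<otimes> inv (rep D)) =
        (\<Sum>C\<in>B. f1 (x \<otimes> inv (rep C)) * f2 (rep C \<otimes> inv (rep D)))" if D: "D \<in> A" for D
    proof -
      let ?d = "rep D"
      have "hecke_conv G H f1 f2 (x \<otimes> inv ?d) =
          coset_sum G H (\<lambda>y. f1 (x \<otimes> inv ?d \<otimes> inv (y \<otimes> inv ?d)) * f2 (y \<otimes> inv ?d))"
        using coset_sum_shift[OF _ conv_linv[OF f1 f2], of "inv ?d" "x \<otimes> inv ?d"] x d[OF D]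
        by (simp add: hecke_conv_def)
      also have "\<dots> = coset_sum G H (\<lambda>y. f1 (x \<otimes> inv y) * f2 (y \<otimes> inv ?d))"
      proof (rule coset_sum_cong)
        fix y assume y: "y \<in> carrier G"
        have "inv ?d \<otimes> (?d \<otimes> inv y) = inv y" using d[OF D] y by (simp add: m_assoc[symmetric])
        hence "x \<otimes> inv ?d \<otimes> inv (y \<otimes> inv ?d) = x \<otimes> inv y"
          using x y d[OF D] by (simp add: inv_mult_group m_assoc)
        thus "f1 (x \<otimes> inv ?d \<otimes> inv (y \<otimes> inv ?d)) * f2 (y \<otimes> inv ?d) =
          f1 (x \<otimes> inv y) * f2 (y \<otimes> inv ?d)" by simp
      qed
      also have "\<dots> = (\<Sum>C\<in>B. f1 (x \<otimes> inv (rep C)) * f2 (rep C \<otimes> inv ?d))"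
      proof (rule coset_sum_superset[OF B(1) _ B(2)])
        have "coset_support G H (\<lambda>y. f1 (x \<otimes> inv y) * f2 (y \<otimes> inv ?d)) \<subseteq>
          coset_support G H (\<lambda>y. f2 (y \<otimes> inv ?d))" by (auto simp: coset_support_def)
        thus "coset_support G H (\<lambda>y. f1 (x \<otimes> inv y) * f2 (y \<otimes> inv ?d)) \<subseteq> B"
          using D by (auto simp: B_def)
      qed
      finally show ?thesis .
    qed
    have "hecke_conv G H (hecke_conv G H f1 f2) f3 x =
        (\<Sum>D\<in>A. (\<Sum>C\<in>B. f1 (x \<otimes> inv (rep C)) * f2 (rep C \<otimes> inv (rep D))) * f3 (rep D))"
      by (simp add: conv_eq[OF x A] inner)
    also have "\<dots> = (\<Sum>C\<in>B. \<Sum>D\<in>A.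
        f1 (x \<otimes> inv (rep C)) * f2 (rep C \<otimes> inv (rep D)) * f3 (rep D))"
      by (subst sum.swap) (simp add: sum_distrib_right)
    also have "\<dots> = (\<Sum>C\<in>B. f1 (x \<otimes> inv (rep C)) * hecke_conv G H f2 f3 (rep C))"
    proof (rule sum.cong[OF refl])
      fix C assume "C \<in> B"
      hence "rep C \<in> carrier G" using B(2) rcosetD(3) by blast
      thus "(\<Sum>D\<in>A. f1 (x \<otimes> inv (rep C)) * f2 (rep C \<otimes> inv (rep D)) * f3 (rep D)) =
          f1 (x \<otimes> inv (rep C)) * hecke_conv G H f2 f3 (rep C)"
        by (simp add: conv_eq[OF _ A] sum_distrib_left mult.assoc)
    qed
    also have "\<dots> = hecke_conv G H f1 (hecke_conv G H f2 f3) x"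
      by (simp add: conv_eq[OF x B(1,3,2)])
    finally show ?thesis .
  qed
qed

lemma indicator_in_hecke_funs:
  assumes "X \<subseteq> carrier G" "\<And>h x. h \<in> H \<Longrightarrow> x \<in> X \<Longrightarrow> h \<otimes> x \<in> X \<and> x \<otimes> h \<in> X"
    "finite A" "\<And>x. x \<in> X \<Longrightarrow> H #> x \<in> A"
  shows "indicator X \<in> hecke_funs G H"
proof -
  have l: "h \<otimes> x \<in> X \<longleftrightarrow> x \<in> X" "x \<otimes> h \<in> X \<longleftrightarrow> x \<in> X" if h: "h \<in> H" and x: "x \<in> carrier G" for h x
  proof -
    have "inv h \<otimes> (h \<otimes> x) = x" "(x \<otimes> h) \<otimes> inv h = x"
      using h x by (simp_all add: m_assoc[symmetric]) (simp add: m_assoc)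
    thus "h \<otimes> x \<in> X \<longleftrightarrow> x \<in> X" "x \<otimes> h \<in> X \<longleftrightarrow> x \<in> X"
      using assms(2)[OF h] assms(2)[OF m_inv_closed[OF h]] by metis+
  qed
  have "coset_support G H (indicator X) \<subseteq> A"
  proof
    fix C assume "C \<in> coset_support G H (indicator X)"
    then obtain x where x: "C \<in> rcosets H" "x \<in> C" "x \<in> X"
      by (auto simp: coset_support_def indicator_def split: if_splits)
    thus "C \<in> A" using assms(4) rcosetD(4) by metis
  qed
  hence "finite (coset_support G H (indicator X))" using assms(3) finite_subset by blast
  thus ?thesis using l assms(1) by (auto simp: hecke_funs_def indicator_def)
qed

lemma one_in_hecke_funs: "indicator H \<in> hecke_funs G H"
proof (rule indicator_in_hecke_funs[where A = "{H}"])
  show "H #> x \<in> {H}" if "x \<in> H" for x using that coset_join2[OF _ subgroup_axioms, of x] by simp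
qed (use subset in auto)

lemma one_conv:
  assumes f: "f \<in> hecke_funs G H"
  shows "hecke_conv G H (indicator H) f = f"
proof
  fix x
  show "hecke_conv G H (indicator H) f x = f x"
  proof (cases "x \<in> carrier G")
    case False thus ?thesis using hecke_funsD(1)[OF f] by (simp add: hecke_conv_def)
  next
    case x: True
    let ?F = "\<lambda>y. indicator H (x \<otimes> inv y) * f y"
    have "coset_support G H ?F \<subseteq> {H #> x}"
    proof
      fix C assume "C \<in> coset_support G H ?F"
      then obtain y where y: "C \<in> rcosets H" "y \<in> C" "x \<otimes> inv y \<in> H"
        by (auto simp: coset_support_def indicator_def split: if_splits)
      have yc: "y \<in> carrier G" "C = H #> y" using rcosetD y by blast+
      have "x \<in> H #> y" using rcos_module_rev[OF is_group yc(1) x y(3)] .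
      thus "C \<in> {H #> x}" using rcosetD(4)[OF y(1)] yc by auto
    qed
    hence "hecke_conv G H (indicator H) f x = ?F (rep (H #> x))"
      using x coset_sum_superset[of "{H #> x}" ?F] mem_rcoset_self(2)[OF x]
      by (simp add: hecke_conv_def)
    also have "\<dots> = ?F x"
      by (rule linv_const[OF conv_linv[OF one_in_hecke_funs f x] mem_rcoset_self(2)[OF x]])
        (use rcosetD(2) mem_rcoset_self x in blast)+
    finally show ?thesis using x by simp
  qed
qed

lemma conv_one:
  assumes f: "f \<in> hecke_funs G H"
  shows "hecke_conv G H f (indicator H) = f"
proof
  fix x
  show "hecke_conv G H f (indicator H) x = f x"
  proof (cases "x \<in> carrier G")
    case False thus ?thesis using hecke_funsD(1)[OF f] by (simp add: hecke_conv_def)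
  next
    case x: True
    have HR: "H \<in> rcosets H" using subgroup_in_rcosets[OF is_group] .
    have "coset_support G H (indicator H) \<subseteq> {H}"
    proof
      fix C assume "C \<in> coset_support G H (indicator H)"
      then obtain y where "C \<in> rcosets H" "y \<in> C" "y \<in> H"
        by (auto simp: coset_support_def indicator_def split: if_splits)
      thus "C \<in> {H}" using rcosetD(4) HR by blast
    qed
    hence "hecke_conv G H f (indicator H) x = f (x \<otimes> inv (rep H)) * indicator H (rep H)"
      using x HR conv_eq[of x "{H}"] by simp
    moreover have "rep H \<in> H" using rcosetD(2)[OF HR] .
    ultimately show ?thesis using hecke_funsD(3)[OF f _ x] by simp
  qed
qed

lemma support_add:
  "coset_support G H (\<lambda>x. f x + g x) \<subseteq> coset_support G H f \<union> coset_support G H g"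
  by (auto simp: coset_support_def)

lemma hecke_funs_add:
  "f \<in> hecke_funs G H \<Longrightarrow> g \<in> hecke_funs G H \<Longrightarrow> (\<lambda>x. f x + g x) \<in> hecke_funs G H"
  using finite_subset[OF support_add[of f g]] by (simp add: hecke_funs_def)

lemma hecke_funs_minus: "f \<in> hecke_funs G H \<Longrightarrow> (\<lambda>x. - f x) \<in> hecke_funs G H"
  by (simp add: hecke_funs_def coset_support_def)

lemma hecke_funs_zero: "(\<lambda>x. 0) \<in> hecke_funs G H"
  by (simp add: hecke_funs_def coset_support_def)

lemma conv_add_right:
  assumes "f \<in> hecke_funs G H" "g \<in> hecke_funs G H"
  shows "hecke_conv G H k (\<lambda>x. f x + g x) x = hecke_conv G H k f x + hecke_conv G H k g x"
proof (cases "x \<in> carrier G")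
  case x: True
  let ?A = "coset_support G H f \<union> coset_support G H g"
  have A: "finite ?A" "?A \<subseteq> rcosets H"
    using assms hecke_funsD(4) coset_support_subset by auto
  show ?thesis
    using support_add[of f g] by (simp add: conv_eq[OF x A(1) _ A(2)] sum.distrib algebra_simps)
qed (simp add: hecke_conv_def)

lemma conv_add_left:
  assumes "k \<in> hecke_funs G H"
  shows "hecke_conv G H (\<lambda>x. f x + g x) k x = hecke_conv G H f k x + hecke_conv G H g k x"
proof (cases "x \<in> carrier G")
  case x: True
  show ?thesis
    by (simp add: conv_eq[OF x hecke_funsD(4)[OF assms] order_refl coset_support_subset]
        sum.distrib algebra_simps)
qed (simp add: hecke_conv_def)

end


section \<open>The Hecke algebra \<open>\<H>\<^sub>\<int>(\<Gamma>, \<Gamma>\<^sub>0)\<close>\<close>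

definition pmat :: "rat \<Rightarrow> rat \<Rightarrow> rat^2^2" where
  "pmat b a = vector [vector [1, b], vector [0, a]]"

definition PQ :: "(rat^2^2) monoid" where
  "PQ = \<lparr>carrier = {pmat b a | b a. 0 < a}, mult = (**), one = mat 1\<rparr>"

definition PZ :: "(rat^2^2) set" where
  "PZ = {pmat b 1 | b. b \<in> \<int>}"

lemma pmat_mult: "pmat b a ** pmat d c = pmat (d + b * c) (a * c)"
  by (simp add: pmat_def matrix_matrix_mult_def vec_eq_iff forall_2 sum_2)

lemma pmat_one: "mat 1 = pmat 0 1"
  by (simp add: pmat_def mat_def vec_eq_iff forall_2)

lemma pmat_inject: "pmat b a = pmat d c \<longleftrightarrow> b = d \<and> a = c"
  by (auto simp: pmat_def vec_eq_iff forall_2)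

lemma pmat_in_PQ: "pmat b a \<in> carrier PQ \<longleftrightarrow> 0 < a"
  by (auto simp: PQ_def pmat_inject)

lemma pmat_in_PZ: "pmat (of_int m) 1 \<in> PZ"
  by (auto simp: PZ_def)

lemma PQ_simps: "x \<otimes>\<^bsub>PQ\<^esub> y = x ** y" "\<one>\<^bsub>PQ\<^esub> = mat 1"
  by (simp_all add: PQ_def)

lemma group_PQ: "group PQ"
proof (rule groupI)
  fix x y z assume "x \<in> carrier PQ" "y \<in> carrier PQ" "z \<in> carrier PQ"
  thus "x \<otimes>\<^bsub>PQ\<^esub> y \<otimes>\<^bsub>PQ\<^esub> z = x \<otimes>\<^bsub>PQ\<^esub> (y \<otimes>\<^bsub>PQ\<^esub> z)" by (simp add: PQ_def matrix_mul_assoc)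
next
  fix x assume "x \<in> carrier PQ"
  then obtain b a where x: "x = pmat b a" "0 < a" by (auto simp: PQ_def)
  show "\<exists>y\<in>carrier PQ. y \<otimes>\<^bsub>PQ\<^esub> x = \<one>\<^bsub>PQ\<^esub>"
    by (rule bexI[of _ "pmat (- b / a) (1 / a)"])
      (use x in \<open>simp_all add: pmat_in_PQ PQ_simps pmat_mult pmat_one\<close>)
qed (auto simp: PQ_def pmat_mult pmat_one pmat_inject)

lemma pmat_inv: "0 < a \<Longrightarrow> inv\<^bsub>PQ\<^esub> (pmat b a) = pmat (- b / a) (1 / a)"
  by (rule group.inv_equality[OF group_PQ])
    (simp_all add: pmat_in_PQ PQ_simps pmat_mult pmat_one)

lemma subgroup_PZ: "subgroup PZ PQ"
proof (rule group.subgroupI[OF group_PQ])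
  fix x y assume "x \<in> PZ" "y \<in> PZ"
  thus "inv\<^bsub>PQ\<^esub> x \<in> PZ" "x \<otimes>\<^bsub>PQ\<^esub> y \<in> PZ"
    by (auto simp: PZ_def pmat_inv) (auto simp: PQ_def pmat_mult pmat_inject)
qed (auto simp: pmat_in_PQ PZ_def intro: Ints_0)

interpretation P: group_with_subgroup PQ PZ
  by (simp add: group_with_subgroup_def group_PQ subgroup_PZ)

lemma double_coset_pmat:
  "double_coset PQ PZ (pmat b a) = {pmat (b + of_int k * a + of_int l) a | k l. True}"
  (is "?L = ?R")
proof
  show "?L \<subseteq> ?R"
  proof
    fix x assume "x \<in> ?L"
    then obtain k l where "x = (pmat (of_int k) 1 ** pmat b a) ** pmat (of_int l) 1"
      by (auto simp: double_coset_def set_mult_def r_coset_def PZ_def PQ_def elim!: Ints_cases)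
    hence "x = pmat (b + of_int k * a + of_int l) a" by (simp add: pmat_mult pmat_inject)
    thus "x \<in> ?R" by blast
  qed
  show "?R \<subseteq> ?L"
  proof
    fix x assume "x \<in> ?R"
    then obtain k l where x: "x = pmat (b + of_int k * a + of_int l) a" by auto
    have "x = (pmat (of_int k) 1 ** pmat b a) ** pmat (of_int l) 1"
      by (simp add: x pmat_mult pmat_inject)
    moreover note pmat_in_PZ
    ultimately show "x \<in> ?L"
      by (auto simp: double_coset_def set_mult_def r_coset_def PQ_def)
  qed
qed

lemma double_coset_in_hecke_funs:
  assumes "g \<in> carrier PQ"
  shows "indicator (double_coset PQ PZ g) \<in> hecke_funs PQ PZ"
proof -
  obtain b a where g: "g = pmat b a" "0 < a" using assms by (auto simp: PQ_def)
  obtain p q where pq: "quotient_of a = (p, q)" by (cases "quotient_of a")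
  have q: "q > 0" using quotient_of_denom_pos[OF pq] .
  have a: "a = of_int p / of_int q" using quotient_of_div[OF pq] .
  have p: "p > 0" using g(2) a q by (simp add: zero_less_divide_iff)
  have qa: "of_int q * a = of_int p" using a q by simp
  show ?thesis unfolding g(1) double_coset_pmat
  proof (rule P.indicator_in_hecke_funs[
        where A = "(\<lambda>i. PZ #>\<^bsub>PQ\<^esub> pmat (b + of_int i) a) ` {0..<p}"])
    show "{pmat (b + of_int k * a + of_int l) a |k l. True} \<subseteq> carrier PQ"
      using g by (auto simp: PQ_def)
  next
    fix h x assume "h \<in> PZ" "x \<in> {pmat (b + of_int k * a + of_int l) a |k l. True}"
    then obtain m k l where hx: "h = pmat (of_int m) 1" "x = pmat (b + of_int k * a + of_int l) a"
      by (auto simp: PZ_def elim!: Ints_cases)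
    have "h \<otimes>\<^bsub>PQ\<^esub> x = pmat (b + of_int (k + m) * a + of_int l) a"
      "x \<otimes>\<^bsub>PQ\<^esub> h = pmat (b + of_int k * a + of_int (l + m)) a"
      by (simp_all add: hx PQ_def pmat_mult pmat_inject algebra_simps)
    thus "h \<otimes>\<^bsub>PQ\<^esub> x \<in> {pmat (b + of_int k * a + of_int l) a |k l. True} \<and>
      x \<otimes>\<^bsub>PQ\<^esub> h \<in> {pmat (b + of_int k * a + of_int l) a |k l. True}" by blast
  next
    fix x assume "x \<in> {pmat (b + of_int k * a + of_int l) a |k l. True}"
    then obtain k l where x: "x = pmat (b + of_int k * a + of_int l) a" by auto
    let ?i = "l mod p" and ?m = "l div p"
    have i: "?i \<in> {0..<p}" using p by simp
    have "(of_int l :: rat) = of_int (?i + p * ?m)" by simp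
    also have "\<dots> = of_int ?i + of_int p * of_int ?m" by (simp only: of_int_add of_int_mult)
    also have "\<dots> = of_int ?i + of_int (q * ?m) * a"
      by (simp only: of_int_mult qa[symmetric] mult_ac)
    finally have "x = pmat (of_int (k + q * ?m)) 1 \<otimes>\<^bsub>PQ\<^esub> pmat (b + of_int ?i) a"
      by (simp add: x PQ_def pmat_mult pmat_inject algebra_simps)
    moreover have "pmat (of_int (k + q * ?m)) 1 \<in> PZ" by (rule pmat_in_PZ)
    ultimately have "x \<in> PZ #>\<^bsub>PQ\<^esub> pmat (b + of_int ?i) a" by (auto simp: r_coset_def)
    moreover have "pmat (b + of_int ?i) a \<in> carrier PQ" using g by (auto simp: PQ_def)
    ultimately have "PZ #>\<^bsub>PQ\<^esub> x = PZ #>\<^bsub>PQ\<^esub> pmat (b + of_int ?i) a"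
      using P.rcosetD(4) P.mem_rcoset_self(2) by metis
    thus "PZ #>\<^bsub>PQ\<^esub> x \<in> (\<lambda>i. PZ #>\<^bsub>PQ\<^esub> pmat (b + of_int i) a) ` {0..<p}" using i by blast
  qed simp
qed

definition hecke_X :: "pnat \<Rightarrow> (rat^2^2) set" where
  "hecke_X n = double_coset PQ PZ (pmat 0 (of_nat (nat_of_pnat n)))"

lemma set_inv_hecke_X: "set_inv\<^bsub>PQ\<^esub> (hecke_X n) = double_coset PQ PZ (pmat 0 (1 / of_nat (nat_of_pnat n)))"
proof -
  define m :: rat where "m = of_nat (nat_of_pnat n)"
  have m: "0 < m" by (simp add: m_def)
  have X: "hecke_X n = {pmat (0 + of_int k * m + of_int l) m | k l. True}"
    by (simp add: hecke_X_def m_def double_coset_pmat)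
  show ?thesis unfolding double_coset_pmat m_def[symmetric]
  proof (intro equalityI subsetI)
    fix x assume "x \<in> set_inv\<^bsub>PQ\<^esub> (hecke_X n)"
    then obtain k l where "x = inv\<^bsub>PQ\<^esub> (pmat (0 + of_int k * m + of_int l) m)"
      unfolding X SET_INV_def by blast
    also have "\<dots> = pmat (0 + of_int (- l) * (1 / m) + of_int (- k)) (1 / m)"
      using m by (simp add: pmat_inv pmat_inject field_simps)
    finally show "x \<in> {pmat (0 + of_int k * (1 / m) + of_int l) (1 / m) | k l. True}" by blast
  next
    fix x assume "x \<in> {pmat (0 + of_int k * (1 / m) + of_int l) (1 / m) | k l. True}"
    then obtain k l where "x = pmat (0 + of_int k * (1 / m) + of_int l) (1 / m)" by blast
    also have "\<dots> = inv\<^bsub>PQ\<^esub> (pmat (0 + of_int (- l) * m + of_int (- k)) m)"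
      using m by (simp add: pmat_inv pmat_inject field_simps)
    finally show "x \<in> set_inv\<^bsub>PQ\<^esub> (hecke_X n)" unfolding X SET_INV_def by blast
  qed
qed

typedef hecke = "hecke_funs PQ PZ"
  using P.hecke_funs_zero by blast

setup_lifting type_definition_hecke

instantiation hecke :: ring_1
begin

lift_definition zero_hecke :: hecke is "\<lambda>_. 0" by (rule P.hecke_funs_zero)

lift_definition one_hecke :: hecke is "indicator PZ" by (rule P.one_in_hecke_funs)

lift_definition plus_hecke :: "hecke \<Rightarrow> hecke \<Rightarrow> hecke" is "\<lambda>f g x. f x + g x"
  by (rule P.hecke_funs_add)

lift_definition uminus_hecke :: "hecke \<Rightarrow> hecke" is "\<lambda>f x. - f x"
  by (rule P.hecke_funs_minus)

lift_definition minus_hecke :: "hecke \<Rightarrow> hecke \<Rightarrow> hecke" is "\<lambda>f g x. f x - g x"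
  by (simp only: diff_conv_add_uminus P.hecke_funs_add P.hecke_funs_minus)

lift_definition times_hecke :: "hecke \<Rightarrow> hecke \<Rightarrow> hecke" is "hecke_conv PQ PZ"
  by (rule P.conv_closed)

instance
proof
  fix a b c :: hecke
  show "a * b * c = a * (b * c)" by transfer (rule P.conv_assoc)
  show "1 * a = a" by transfer (rule P.one_conv)
  show "a * 1 = a" by transfer (rule P.conv_one)
  show "(a + b) * c = a * c + b * c" by transfer (rule ext, rule P.conv_add_left)
  show "a * (b + c) = a * b + a * c" by transfer (rule ext, rule P.conv_add_right)
  show "a + b + c = a + (b + c)" "a + b = b + a" "0 + a = a" "- a + a = 0" "a - b = a + - b"
    by (transfer; simp add: fun_eq_iff)+
  show "(0::hecke) \<noteq> 1"
  proof transfer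
    have "(indicator PZ :: _ \<Rightarrow> int) \<one>\<^bsub>PQ\<^esub> \<noteq> 0" by simp
    thus "(\<lambda>_. 0 :: int) \<noteq> indicator PZ" by (rule contrapos_nn) (erule subst, rule refl)
  qed
qed

end

lift_definition hecke_e :: "qmodz \<Rightarrow> hecke" is
  "\<lambda>r. indicator (double_coset PQ PZ (pmat r 1))"
proof -
  fix r s :: rat assume "r - s \<in> \<int>"
  then obtain m where "r - s = of_int m" by (auto elim: Ints_cases)
  hence m: "r = s + of_int m" by simp
  have "double_coset PQ PZ (pmat r 1) = double_coset PQ PZ (pmat s 1)"
    unfolding double_coset_pmat
  proof (intro equalityI subsetI)
    fix x assume "x \<in> {pmat (r + of_int k * 1 + of_int l) 1 | k l. True}"
    then obtain k l where "x = pmat (r + of_int k * 1 + of_int l) 1" by blast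
    hence "x = pmat (s + of_int (k + m) * 1 + of_int l) 1" by (simp add: m pmat_inject)
    thus "x \<in> {pmat (s + of_int k * 1 + of_int l) 1 | k l. True}" by blast
  next
    fix x assume "x \<in> {pmat (s + of_int k * 1 + of_int l) 1 | k l. True}"
    then obtain k l where "x = pmat (s + of_int k * 1 + of_int l) 1" by blast
    hence "x = pmat (r + of_int (k - m) * 1 + of_int l) 1" by (simp add: m pmat_inject)
    thus "x \<in> {pmat (r + of_int k * 1 + of_int l) 1 | k l. True}" by blast
  qed
  moreover have "indicator (double_coset PQ PZ (pmat r 1)) \<in> hecke_funs PQ PZ"
    by (rule double_coset_in_hecke_funs) (simp add: pmat_in_PQ)
  ultimately show "indicator (double_coset PQ PZ (pmat r 1)) \<in> hecke_funs PQ PZ \<and>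
    indicator (double_coset PQ PZ (pmat r 1)) =
    (indicator (double_coset PQ PZ (pmat s 1)) :: _ \<Rightarrow> int)"
    by simp
qed

lift_definition hecke_nu :: "pnat \<Rightarrow> hecke" is "\<lambda>n. indicator (hecke_X n)"
  unfolding hecke_X_def by (rule double_coset_in_hecke_funs) (simp add: pmat_in_PQ)

lift_definition hecke_nu_star :: "pnat \<Rightarrow> hecke" is "\<lambda>n. indicator (set_inv\<^bsub>PQ\<^esub> (hecke_X n))"
  unfolding set_inv_hecke_X by (rule double_coset_in_hecke_funs) (simp add: pmat_in_PQ)


section \<open>Ring isomorphisms\<close>

definition ring_isomorphism :: "('a::ring_1 \<Rightarrow> 'b::ring_1) \<Rightarrow> bool" where
  "ring_isomorphism \<phi> \<longleftrightarrow> bij \<phi> \<and> \<phi> 1 = 1 \<and>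
     (\<forall>x y. \<phi> (x + y) = \<phi> x + \<phi> y) \<and> (\<forall>x y. \<phi> (x * y) = \<phi> x * \<phi> y)"

end

theory Submission
  imports Defs
begin

text \<open>The generators of the Hecke algebra satisfy the defining relations of \<open>\<A>\<^sub>\<int>\<close>, which gives a
  homomorphism from \<open>\<A>\<^sub>\<int>\<close> to the Hecke algebra; \<open>\<phi>\<close> is its inverse.  In the Hecke algebra,
  \<open>\<nu>\<^sub>n e(s) \<nu>\<^sub>m\<^sup>*\<close> with \<open>(n, m) = 1\<close> and \<open>s\<close> the class of \<open>q\<close> is the indicator function of the double
  coset of the matrix with entries \<open>b = q / m\<close> and \<open>a = n / m\<close>, and every double coset arises exactly
  once in this way.  So these elements form a \<open>\<int>\<close>-basis, and coordinates are read off by evaluation.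
  In \<open>\<A>\<^sub>\<int>\<close> the corresponding monomials span: left multiplication by a generator preserves their
  span, after common factors of \<open>n\<close> and \<open>m\<close> are removed with \<open>\<rho>\<close>, or with \<open>\<mu>\<^sub>g\<^sup>* \<mu>\<^sub>g = g\<close>.\<close>


section \<open>Integral linear combinations\<close>

text \<open>The Z-linear extension of \<open>v\<close> to the free abelian group on the index
  type.\<close>

definition int_comb :: "('i \<Rightarrow> 'a::ring_1) \<Rightarrow> ('i \<Rightarrow>\<^sub>0 int) \<Rightarrow> 'a" where
  "int_comb v x = (\<Sum>i\<in>Poly_Mapping.keys x. of_int (Poly_Mapping.lookup x i) * v i)"

lemma int_comb_superset:
  assumes "finite A" "Poly_Mapping.keys x \<subseteq> A"
  shows "int_comb v x = (\<Sum>i\<in>A. of_int (Poly_Mapping.lookup x i) * v i)"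
  unfolding int_comb_def
  by (rule sum.mono_neutral_left) (use assms in \<open>auto simp: in_keys_iff\<close>)

lemma int_comb_zero [simp]: "int_comb v 0 = 0"
  by (simp add: int_comb_def)

lemma int_comb_frag_of [simp]: "int_comb v (frag_of i) = v i"
  by (simp add: int_comb_def)

lemma int_comb_add: "int_comb v (x + y) = int_comb v x + int_comb v y"
proof -
  let ?A = "Poly_Mapping.keys x \<union> Poly_Mapping.keys y"
  have k: "Poly_Mapping.keys (x + y) \<subseteq> ?A" by (rule Poly_Mapping.keys_add)
  show ?thesis
    by (simp add: int_comb_superset[of ?A] k lookup_add algebra_simps sum.distrib)
qed

lemma int_comb_diff: "int_comb v (x - y) = int_comb v x - int_comb v y"
  using int_comb_add[of v "x - y" y] by simp

lemma int_comb_sum: "int_comb v (\<Sum>i\<in>I. f i) = (\<Sum>i\<in>I. int_comb v (f i))"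
  by (induction I rule: infinite_finite_induct) (simp_all add: int_comb_add)

text \<open>Differences are what \<open>frag_induction\<close> builds elements from. The lemma
  serves \<open>bc_to_hecke\<close> and also the arbitrary candidate in the uniqueness
  proof.\<close>

lemma int_comb_hom:
  assumes "\<And>x y. \<phi> (x - y) = \<phi> x - \<phi> y" "Poly_Mapping.keys x \<subseteq> S"
    "\<And>i. i \<in> S \<Longrightarrow> \<phi> (v i) = w i"
  shows "\<phi> (int_comb v x) = int_comb w x"
  using assms(2)
proof (induction x rule: frag_induction)
  case zero
  show ?case using assms(1)[of 0 0] by simp
qed (simp_all add: assms int_comb_diff)


section \<open>Evaluation of Hecke operators\<close>

text \<open>In these coordinates, right multiplication by a generator becomes a finite sum of values
  at shifted and rescaled arguments.\<close>

definition hval :: "hecke \<Rightarrow> rat \<Rightarrow> rat \<Rightarrow> int" where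
  "hval x b a = Rep_hecke x (pmat b a)"

abbreviation qn :: "pnat \<Rightarrow> rat" where "qn n \<equiv> of_nat (nat_of_pnat n)"

lemma hecke_eqI:
  assumes "\<And>b a. 0 < a \<Longrightarrow> hval x b a = hval y b a"
  shows "x = y"
proof -
  have "Rep_hecke x g = Rep_hecke y g" for g
  proof (cases "g \<in> carrier PQ")
    case True
    then obtain b a where "g = pmat b a" "0 < a" by (auto simp: PQ_def)
    thus ?thesis using assms[of a b] by (simp add: hval_def)
  next
    case False
    thus ?thesis using P.hecke_funsD(1)[OF Rep_hecke] by simp
  qed
  thus ?thesis by (simp add: Rep_hecke_inject[symmetric] fun_eq_iff)
qed

lemma hval_zero [simp]: "hval 0 b a = 0"
  by (simp add: hval_def zero_hecke.rep_eq)

lemma hval_add [simp]: "hval (x + y) b a = hval x b a + hval y b a"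
  by (simp add: hval_def plus_hecke.rep_eq)

lemma hval_diff [simp]: "hval (x - y) b a = hval x b a - hval y b a"
  by (simp add: hval_def minus_hecke.rep_eq)

lemma hval_sum: "hval (\<Sum>i\<in>I. f i) b a = (\<Sum>i\<in>I. hval (f i) b a)"
  by (induction I rule: infinite_finite_induct) simp_all

lemma hval_of_nat_mult: "hval (of_nat k * x) b a = int k * hval x b a"
  by (induction k) (simp_all add: algebra_simps)

text \<open>Bi-invariance in coordinates: the left factor from \<open>PZ\<close> contributes
  \<open>k * a\<close>, the right one contributes \<open>l\<close>.\<close>

lemma hval_translate:
  assumes "0 < a"
  shows "hval f (b + of_int k * a + of_int l) a = hval f b a"
proof -
  have c: "pmat b a \<in> carrier PQ" "pmat (b + of_int k * a) a \<in> carrier PQ"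
    using assms by (simp_all add: pmat_in_PQ)
  have "hval f (b + of_int k * a + of_int l) a =
      Rep_hecke f (pmat (b + of_int k * a) a \<otimes>\<^bsub>PQ\<^esub> pmat (of_int l) 1)"
    by (simp add: hval_def PQ_simps pmat_mult algebra_simps)
  also have "\<dots> = Rep_hecke f (pmat (b + of_int k * a) a)"
    by (rule P.hecke_funsD(3)[OF Rep_hecke pmat_in_PZ c(2)])
  also have "pmat (b + of_int k * a) a = pmat (of_int k) 1 \<otimes>\<^bsub>PQ\<^esub> pmat b a"
    by (simp add: PQ_simps pmat_mult)
  also have "Rep_hecke f \<dots> = Rep_hecke f (pmat b a)"
    by (rule P.hecke_funsD(2)[OF Rep_hecke pmat_in_PZ c(1)])
  finally show ?thesis by (simp add: hval_def)
qed

lemma hval_one: "hval 1 b a = of_bool (a = 1 \<and> b \<in> \<int>)"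
  by (auto simp: hval_def one_hecke.rep_eq indicator_def PZ_def pmat_inject)

lemma hval_e: "hval (hecke_e r) b a = of_bool (a = 1 \<and> abs_qmodz b = r)"
proof -
  obtain q where q: "r = abs_qmodz q" using qmodz_abs_surj by blast
  have "(\<exists>k l. b = q + of_int k + of_int l) \<longleftrightarrow> b - q \<in> \<int>"
  proof
    assume "b - q \<in> \<int>"
    then obtain k where "b - q = of_int k" by (auto elim: Ints_cases)
    hence "b = q + of_int k + of_int 0" by simp
    thus "\<exists>k l. b = q + of_int k + of_int l" by blast
  qed auto
  moreover have "Rep_hecke (hecke_e r) = indicator (double_coset PQ PZ (pmat q 1))"
    unfolding q hecke_e.abs_eq
    by (intro Abs_hecke_inverse double_coset_in_hecke_funs) (simp add: pmat_in_PQ)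
  ultimately show ?thesis
    by (auto simp: hval_def q indicator_def double_coset_pmat pmat_inject qmodz.abs_eq_iff)
qed

lemma hval_nu: "hval (hecke_nu n) b a = of_bool (a = qn n \<and> b \<in> \<int>)"
proof -
  have "(\<exists>k l. b = of_int k * qn n + of_int l) \<longleftrightarrow> b \<in> \<int>"
  proof
    assume "b \<in> \<int>"
    then obtain k where "b = of_int 0 * qn n + of_int k" by (auto elim: Ints_cases)
    thus "\<exists>k l. b = of_int k * qn n + of_int l" by blast
  qed auto
  thus ?thesis
    by (auto simp: hval_def hecke_nu.rep_eq hecke_X_def indicator_def double_coset_pmat
        pmat_inject)
qed

lemma hval_nu_star:
  "hval (hecke_nu_star n) b a = of_bool (a * qn n = 1 \<and> b * qn n \<in> \<int>)"
proof -
  have "(\<exists>k l. b = of_int k / qn n + of_int l) \<longleftrightarrow> b * qn n \<in> \<int>"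
  proof
    assume "\<exists>k l. b = of_int k / qn n + of_int l"
    then obtain k l where "b * qn n = of_int k + of_int l * qn n"
      by (auto simp: field_simps)
    thus "b * qn n \<in> \<int>" by simp
  next
    assume "b * qn n \<in> \<int>"
    then obtain k where "b * qn n = of_int k" by (auto elim: Ints_cases)
    hence "b = of_int k / qn n + of_int 0" by (simp add: field_simps)
    thus "\<exists>k l. b = of_int k / qn n + of_int l" by blast
  qed
  thus ?thesis
    by (auto simp: hval_def hecke_nu_star.rep_eq set_inv_hecke_X indicator_def double_coset_pmat
        pmat_inject field_simps)
qed


section \<open>Right multiplication by the generators\<close>

text \<open>Right invariance of \<open>f\<close> makes \<open>f (x \<otimes> inv y)\<close> constant
  on each coset \<open>H #> g i\<close>, so the arbitrary representatives in the convolution can be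
  traded for the \<open>g i\<close>. Injectivity counts each coset once.\<close>

lemma (in group_with_subgroup) conv_indicator:
  assumes f: "f \<in> hecke_funs G H" and x: "x \<in> carrier G" and I: "finite I"
    and g: "\<And>i. i \<in> I \<Longrightarrow> g i \<in> carrier G" "inj_on (\<lambda>i. H #> g i) I"
  shows "hecke_conv G H f (indicator (\<Union>i\<in>I. H #> g i)) x = (\<Sum>i\<in>I. f (x \<otimes> inv (g i)))"
proof -
  let ?X = "\<Union>i\<in>I. H #> g i" and ?A = "(\<lambda>i. H #> g i) ` I"
  have A: "?A \<subseteq> rcosets H" using g mem_rcoset_self(2) by auto
  have "coset_support G H (indicator ?X) \<subseteq> ?A"
  proof
    fix C assume "C \<in> coset_support G H (indicator ?X)"
    then obtain y i where y: "C \<in> rcosets H" "y \<in> C" "i \<in> I" "y \<in> H #> g i"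
      by (auto simp: coset_support_def indicator_def split: if_splits)
    moreover have "H #> g i \<in> rcosets H" using y(3) A by auto
    ultimately have "C = H #> g i" using rcosetD(4) by metis
    thus "C \<in> ?A" using y(3) by blast
  qed
  hence "hecke_conv G H f (indicator ?X) x =
      (\<Sum>C\<in>?A. f (x \<otimes> inv (rep C)) * indicator ?X (rep C))"
    using conv_eq[OF x _ _ A] I by simp
  also have "\<dots> = (\<Sum>i\<in>I. f (x \<otimes> inv (rep (H #> g i))) * indicator ?X (rep (H #> g i)))"
    by (simp add: sum.reindex[OF g(2)])
  also have "\<dots> = (\<Sum>i\<in>I. f (x \<otimes> inv (g i)))"
  proof (rule sum.cong[OF refl])
    fix i assume i: "i \<in> I"
    let ?r = "rep (H #> g i)"
    have r: "?r \<in> H #> g i" using rcosetD(2) A i by blast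
    then obtain h where h: "h \<in> H" "?r = h \<otimes> g i" by (auto simp: r_coset_def)
    have "x \<otimes> inv ?r = (x \<otimes> inv (g i)) \<otimes> inv h"
      using h x g(1)[OF i] by (simp add: inv_mult_group m_assoc)
    hence "f (x \<otimes> inv ?r) = f (x \<otimes> inv (g i))"
      using hecke_funsD(3)[OF f] h x g(1)[OF i] by simp
    moreover have "?r \<in> ?X" using r i by blast
    ultimately show "f (x \<otimes> inv ?r) * indicator ?X ?r = f (x \<otimes> inv (g i))" by simp
  qed
  finally show ?thesis .
qed

lemma PZ_rcoset: "PZ #>\<^bsub>PQ\<^esub> pmat d c = {pmat (d + of_int k * c) c | k. True}"
proof -
  have PZ: "PZ = (\<lambda>k. pmat (of_int k) 1) ` UNIV" by (auto simp: PZ_def Ints_def)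
  show ?thesis unfolding PZ r_coset_def PQ_simps by (auto simp: pmat_mult)
qed

text \<open>The condition \<open>(b' - d i) / c \<in> \<int>\<close> is membership of
  \<open>pmat b' c\<close> in the coset of \<open>pmat (d i) c\<close>; thus \<open>y\<close> is the
  indicator of finitely many right cosets sharing the entry \<open>c\<close>. The arguments on the
  right are the entries of \<open>pmat b a\<close> times the inverse of
  \<open>pmat (d i) c\<close>.\<close>

lemma hval_mult:
  assumes a: "0 < a" and c: "0 < c" and I: "finite I"
    and X: "\<And>b' a'. 0 < a' \<Longrightarrow> hval y b' a' = of_bool (a' = c \<and> (\<exists>i\<in>I. (b' - d i) / c \<in> \<int>))"
    and inj: "\<And>i j. i \<in> I \<Longrightarrow> j \<in> I \<Longrightarrow> (d i - d j) / c \<in> \<int> \<Longrightarrow> i = j"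
  shows "hval (x * y) b a = (\<Sum>i\<in>I. hval x ((b - d i) / c) (a / c))"
proof -
  let ?X = "\<Union>i\<in>I. PZ #>\<^bsub>PQ\<^esub> pmat (d i) c"
  have mem: "pmat b' a' \<in> PZ #>\<^bsub>PQ\<^esub> pmat (d i) c \<longleftrightarrow> a' = c \<and> (b' - d i) / c \<in> \<int>" for b' a' i
  proof -
    have "(\<exists>k. b' = d i + of_int k * c) \<longleftrightarrow> (b' - d i) / c \<in> \<int>"
    proof
      assume "(b' - d i) / c \<in> \<int>"
      then obtain k where "(b' - d i) / c = of_int k" by (auto elim: Ints_cases)
      hence "b' = d i + of_int k * c" using c by (simp add: field_simps)
      thus "\<exists>k. b' = d i + of_int k * c" by blast
    qed (use c in auto)
    thus ?thesis by (auto simp: PZ_rcoset pmat_inject)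
  qed
  have "Rep_hecke y g = indicator ?X g" for g
  proof (cases "g \<in> carrier PQ")
    case True
    then obtain b' a' where g: "g = pmat b' a'" "0 < a'" by (auto simp: PQ_def)
    thus ?thesis using X[OF g(2), of b'] by (auto simp: hval_def indicator_def mem)
  next
    case False
    hence "g \<notin> ?X" using c by (auto simp: PZ_rcoset pmat_in_PQ)
    thus ?thesis using False P.hecke_funsD(1)[OF Rep_hecke] by simp
  qed
  hence y: "Rep_hecke y = indicator ?X" by blast
  have "inj_on (\<lambda>i. PZ #>\<^bsub>PQ\<^esub> pmat (d i) c) I"
  proof (rule inj_onI)
    fix i j assume ij: "i \<in> I" "j \<in> I"
      "PZ #>\<^bsub>PQ\<^esub> pmat (d i) c = PZ #>\<^bsub>PQ\<^esub> pmat (d j) c"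
    have "pmat (d i) c \<in> PZ #>\<^bsub>PQ\<^esub> pmat (d i) c" by (simp add: mem)
    hence "(d i - d j) / c \<in> \<int>" unfolding ij(3) mem by blast
    thus "i = j" using inj ij by blast
  qed
  hence "hval (x * y) b a = (\<Sum>i\<in>I. Rep_hecke x (pmat b a \<otimes>\<^bsub>PQ\<^esub> inv\<^bsub>PQ\<^esub> (pmat (d i) c)))"
    unfolding hval_def times_hecke.rep_eq y
    using a c I by (intro P.conv_indicator[OF Rep_hecke]) (auto simp: pmat_in_PQ)
  also have "\<dots> = (\<Sum>i\<in>I. hval x ((b - d i) / c) (a / c))"
    using c by (simp add: hval_def PQ_simps pmat_inv pmat_mult diff_divide_distrib)
  finally show ?thesis .
qed

text \<open>Matrices with lower entry 1 commute, so the double coset is a single right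
  coset.\<close>

lemma hval_mult_e:
  assumes "0 < a"
  shows "hval (x * hecke_e (abs_qmodz q)) b a = hval x (b - q) a"
  using hval_mult[of a 1 "{()}" "hecke_e (abs_qmodz q)" "\<lambda>_. q" x b] assms
  by (simp add: hval_e qmodz.abs_eq_iff)

text \<open>Left translation alone moves \<open>b\<close> through all multiples of
  \<open>1 / m\<close>, so again one coset suffices.\<close>

lemma hval_mult_nu_star:
  assumes "0 < a"
  shows "hval (x * hecke_nu_star m) b a = hval x (b * qn m) (a * qn m)"
  using hval_mult[of a "1 / qn m" "{()}" "hecke_nu_star m" "\<lambda>_. 0" x b] assms
  by (simp add: hval_nu_star field_simps)

text \<open>Since \<open>m\<close> is invertible modulo \<open>n\<close>, exactly one \<open>d < n\<close> satisfies \<open>m d = y\<close> modulo \<open>n\<close>.\<close>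

lemma sum_residues_coprime:
  assumes n: "0 < n" and co: "coprime n m"
  shows "(\<Sum>d<n. of_bool ((y - of_nat m * of_nat d) / of_nat n \<in> (\<int>::rat set))) =
    (of_bool (y \<in> \<int>) :: int)"
proof (cases "y \<in> \<int>")
  case False
  have "(y - of_nat m * of_nat d) / of_nat n \<notin> \<int>" for d
  proof
    assume "(y - of_nat m * of_nat d) / of_nat n \<in> \<int>"
    then obtain k where "(y - of_nat m * of_nat d) / of_nat n = of_int k" by (auto elim: Ints_cases)
    hence "y = of_int k * of_nat n + of_nat m * of_nat d" using n by (simp add: field_simps)
    thus False using False by simp
  qed
  thus ?thesis using False by simp
next
  case True
  then obtain k where k: "y = of_int k" by (auto elim: Ints_cases)
  have iff: "(y - of_nat m * of_nat d) / of_nat n \<in> \<int> \<longleftrightarrow> int n dvd k - int m * int d" for d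
  proof -
    have "(y - of_nat m * of_nat d) / of_nat n = of_int (k - int m * int d) / (of_int (int n) :: rat)"
      by (simp add: k)
    thus ?thesis using n by (simp only: of_int_div_of_int_in_Ints_iff) simp
  qed
  obtain u v where uv: "u * int m + v * int n = 1"
    using bezout_int[of "int m" "int n"] co by (auto simp: coprime_commute)
  \<comment> \<open>By Bezout \<open>u\<close> inverts \<open>m\<close> modulo \<open>n\<close>, so
    the residue of \<open>u k\<close> is the solution.\<close>
  define d0 where "d0 = nat ((u * k) mod int n)"
  have d0: "d0 < n" "int d0 = (u * k) mod int n" using n by (simp_all add: d0_def nat_less_iff)
  have "int n dvd k - int m * int d \<longleftrightarrow> d = d0" if d: "d < n" for d
  proof -
    have "int n dvd k - int m * int d \<longleftrightarrow> int n dvd u * k - int d"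
    proof
      assume "int n dvd k - int m * int d"
      hence "int n dvd u * (k - int m * int d) - int n * v * int d" by (simp add: mult.assoc)
      also have "u * (k - int m * int d) - int n * v * int d =
          u * k - (u * int m + v * int n) * int d" by (simp add: algebra_simps)
      finally show "int n dvd u * k - int d" by (simp add: uv)
    next
      assume "int n dvd u * k - int d"
      hence "int n dvd int m * (u * k - int d) + int n * v * k" by (simp add: mult.assoc)
      also have "int m * (u * k - int d) + int n * v * k =
          (u * int m + v * int n) * k - int m * int d" by (simp add: algebra_simps)
      finally show "int n dvd k - int m * int d" by (simp add: uv)
    qed
    also have "\<dots> \<longleftrightarrow> (u * k) mod int n = int d mod int n" by (simp add: mod_eq_dvd_iff)
    also have "\<dots> \<longleftrightarrow> d = d0" using d d0 by auto
    finally show ?thesis .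
  qed
  hence "(\<Sum>d<n. of_bool ((y - of_nat m * of_nat d) / of_nat n \<in> (\<int>::rat set))) =
      (\<Sum>d<n. of_bool (d = d0) :: int)"
    by (intro sum.cong) (simp_all add: iff)
  thus ?thesis using d0(1) True by (simp add: of_bool_def)
qed

lemmas sum_residues = sum_residues_coprime[where m = 1, simplified]

text \<open>Left translation moves \<open>b\<close> only by multiples of \<open>n\<close>, so the
  double coset splits into \<open>n\<close> right cosets, one for each residue
  \<open>d\<close>.\<close>

lemma hval_mult_nu:
  assumes "0 < a"
  shows "hval (x * hecke_nu n) b a = (\<Sum>d<nat_of_pnat n. hval x ((b - of_nat d) / qn n) (a / qn n))"
proof (rule hval_mult)
  fix b' a' :: rat
  \<comment> \<open>Covering is deduced from counting: a suitable residue exists exactly when the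
    sum of indicators, known from \<open>sum_residues\<close>, is nonzero.\<close>
  have "(\<exists>i<nat_of_pnat n. (b' - of_nat i) / qn n \<in> \<int>) \<longleftrightarrow>
      (\<Sum>d<nat_of_pnat n. of_bool ((b' - of_nat d) / qn n \<in> \<int>)) \<noteq> (0::int)"
    by (subst sum_nonneg_eq_0_iff) auto
  also have "\<dots> \<longleftrightarrow> b' \<in> \<int>" by (simp add: sum_residues)
  finally show "hval (hecke_nu n) b' a' =
      of_bool (a' = qn n \<and> (\<exists>i\<in>{..<nat_of_pnat n}. (b' - of_nat i) / qn n \<in> \<int>))"
    by (simp add: hval_nu Bex_def)
next
  fix i j assume ij: "i \<in> {..<nat_of_pnat n}" "j \<in> {..<nat_of_pnat n}"
    "(of_nat i - of_nat j) / qn n \<in> \<int>"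
  have "(of_nat i - of_nat j) / qn n =
      of_int (int i - int j) / (of_int (int (nat_of_pnat n)) :: rat)" by simp
  hence "int (nat_of_pnat n) dvd int i - int j"
    using ij(3) nat_of_pnat_pos[of n]
    by (simp only: of_int_div_of_int_in_Ints_iff) auto
  hence "int i mod int (nat_of_pnat n) = int j mod int (nat_of_pnat n)"
    by (simp add: mod_eq_dvd_iff)
  thus "i = j" using ij by simp
qed (use assms in auto)


section \<open>The defining relations in the Hecke algebra\<close>

lemma abs_qmodz_simps:
  "abs_qmodz (b - q) = abs_qmodz b - abs_qmodz q" "abs_qmodz 0 = 0"
  "qmodz_scale n (abs_qmodz q) = abs_qmodz (of_nat n * q)"
  by (simp_all add: minus_qmodz.abs_eq zero_qmodz_def qmodz_scale.abs_eq)

lemma abs_qmodz_eq_0_iff: "abs_qmodz b = 0 \<longleftrightarrow> b \<in> \<int>"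
  by (simp add: zero_qmodz_def qmodz.abs_eq_iff)

lemma qn_mult: "qn (n * m) = qn n * qn m"
  by (simp add: times_pnat.rep_eq)

lemma sum_of_bool_conj:
  "(\<Sum>d<N. of_bool (P \<and> Q d)) = (of_bool P :: int) * (\<Sum>d<N::nat. of_bool (Q d))"
  by (cases P) simp_all

lemma hecke_e_0: "hecke_e 0 = 1"
  by (rule hecke_eqI) (simp add: hval_e hval_one abs_qmodz_eq_0_iff)

lemma hecke_e_add: "hecke_e (r + s) = hecke_e r * hecke_e s"
proof -
  obtain q where "s = abs_qmodz q" using qmodz_abs_surj by blast
  thus ?thesis
    by (intro hecke_eqI) (simp add: hval_mult_e hval_e abs_qmodz_simps diff_eq_eq)
qed

text \<open>Both sides test whether \<open>a = 1\<close> and \<open>n b\<close> has class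
  \<open>r\<close>; on the right only the class \<open>s\<close> of \<open>b\<close>
  contributes.\<close>

lemma hecke_nu_e_nu_star:
  "hecke_nu n * hecke_e r * hecke_nu_star n =
    (\<Sum>s | qmodz_scale (nat_of_pnat n) s = r. hecke_e s)"
proof -
  obtain q where q: "r = abs_qmodz q" using qmodz_abs_surj by blast
  show ?thesis
  proof (rule hecke_eqI)
    fix b a :: rat assume a: "0 < a"
    let ?F = "{s. qmodz_scale (nat_of_pnat n) s = r}"
    have "(\<Sum>s\<in>?F. hval (hecke_e s) b a) =
        (\<Sum>s\<in>?F. if abs_qmodz b = s then of_bool (a = 1) else 0)"
      by (intro sum.cong) (auto simp: hval_e)
    also have "\<dots> = of_bool (a = 1 \<and> abs_qmodz b \<in> ?F)"
      by (simp add: qmodz_scale_fibre)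
    also have "abs_qmodz b \<in> ?F \<longleftrightarrow> b * qn n - q \<in> \<int>"
      by (simp add: q abs_qmodz_simps qmodz.abs_eq_iff mult.commute)
    finally show "hval (hecke_nu n * hecke_e r * hecke_nu_star n) b a =
        hval (\<Sum>s\<in>?F. hecke_e s) b a"
      using a by (simp add: hval_sum hval_mult_nu_star q hval_mult_e hval_nu)
  qed
qed

lemma hecke_nu_star_e:
  "hecke_nu_star n * hecke_e r = hecke_e (qmodz_scale (nat_of_pnat n) r) * hecke_nu_star n"
proof -
  obtain q where "r = abs_qmodz q" using qmodz_abs_surj by blast
  thus ?thesis
    by (intro hecke_eqI)
      (simp add: hval_mult_e hval_mult_nu_star hval_nu_star hval_e abs_qmodz_simps
        qmodz.abs_eq_iff algebra_simps)
qed

lemma hecke_e_nu: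
  "hecke_e r * hecke_nu n = hecke_nu n * hecke_e (qmodz_scale (nat_of_pnat n) r)"
proof -
  obtain q where q: "r = abs_qmodz q" using qmodz_abs_surj by blast
  \<comment> \<open>A shift by \<open>q\<close> after division by \<open>n\<close> is a shift by
    \<open>n q\<close> before it, whence the scaling of \<open>r\<close>.\<close>
  have eq: "(b - of_nat d) / qn n - q = (b - qn n * q - of_nat d) / qn n" for b d
    by (simp add: field_simps)
  show ?thesis
    by (rule hecke_eqI)
      (auto simp add: q hval_mult_nu hval_e abs_qmodz_simps(3) hval_mult_e hval_nu qmodz.abs_eq_iff
        eq sum_of_bool_conj sum_residues)
qed

lemma hecke_nu_mult: "hecke_nu (n * m) = hecke_nu n * hecke_nu m"
  by (rule hecke_eqI)
    (auto simp: hval_mult_nu hval_nu sum_of_bool_conj sum_residues qn_mult field_simps)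

lemma hecke_nu_star_mult: "hecke_nu_star (n * m) = hecke_nu_star n * hecke_nu_star m"
  by (rule hecke_eqI) (simp add: hval_mult_nu_star hval_nu_star qn_mult mult_ac)

text \<open>The division by \<open>n\<close> caused by \<open>hecke_nu n\<close> cancels in the test
  made by \<open>hecke_nu_star n\<close>, so all \<open>n\<close> summands equal the value of
  \<open>1\<close>.\<close>

lemma hecke_nu_star_nu: "hecke_nu_star n * hecke_nu n = of_nat (nat_of_pnat n)"
proof (rule hecke_eqI)
  fix b a :: rat assume a: "0 < a"
  have "hval (hecke_nu_star n * hecke_nu n) b a =
      (\<Sum>d<nat_of_pnat n. of_bool (a = 1 \<and> b - of_nat d \<in> \<int>))"
    using a by (simp add: hval_mult_nu hval_nu_star)
  also have "\<dots> = (\<Sum>d<nat_of_pnat n. of_bool (a = 1 \<and> b \<in> \<int>))"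
    by simp
  also have "\<dots> = hval (of_nat (nat_of_pnat n) * 1) b a"
    by (simp only: hval_of_nat_mult hval_one) simp
  finally show "hval (hecke_nu_star n * hecke_nu n) b a = hval (of_nat (nat_of_pnat n)) b a"
    by simp
qed

text \<open>When \<open>b m\<close> is integral, exactly one of the \<open>n\<close> summands on the
  right passes the integrality test, because \<open>m\<close> is invertible modulo
  \<open>n\<close>.\<close>

lemma hecke_nu_nu_star_commute:
  assumes "coprime (nat_of_pnat n) (nat_of_pnat m)"
  shows "hecke_nu n * hecke_nu_star m = hecke_nu_star m * hecke_nu n"
proof (rule hecke_eqI)
  fix b a :: rat assume a: "0 < a"
  have eq: "(b - of_nat d) / qn n * qn m = (b * qn m - qn m * of_nat d) / qn n" for d
    by (simp add: algebra_simps)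
  have "hval (hecke_nu_star m * hecke_nu n) b a =
      of_bool (a / qn n * qn m = 1) * of_bool (b * qn m \<in> \<int>)"
    using a sum_residues_coprime[OF nat_of_pnat_pos assms, of "b * qn m"]
    by (simp add: hval_mult_nu hval_nu_star sum_of_bool_conj eq del: times_divide_eq_left)
  also have "a / qn n * qn m = 1 \<longleftrightarrow> a * qn m = qn n" by (auto simp: field_simps)
  finally show "hval (hecke_nu n * hecke_nu_star m) b a = hval (hecke_nu_star m * hecke_nu n) b a"
    using a by (simp add: hval_mult_nu_star hval_nu)
qed


section \<open>The homomorphism from the presented ring\<close>

fun hecke_gen :: "bc_gen \<Rightarrow> hecke" where
  "hecke_gen (E x) = int_comb hecke_e x"
| "hecke_gen (Mu n) = hecke_nu n"
| "hecke_gen (MuStar n) = hecke_nu_star n"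

lemma sigma_rho_diff:
  "sigma n (x - y) = sigma n x - sigma n y" "rho n (x - y) = rho n x - rho n y"
  "sigma n 0 = 0" "rho n 0 = 0"
  by (simp_all add: sigma_def rho_def frag_extend_diff)

lemma int_comb_e_mult: "int_comb hecke_e (x * y) = int_comb hecke_e x * int_comb hecke_e y"
proof (induction x rule: frag_induct)
  case (single r)
  show ?case
    by (induction y rule: frag_induct)
      (simp_all only: frag_of_mult int_comb_frag_of hecke_e_add int_comb_diff right_diff_distrib
        int_comb_zero mult_zero_right)
qed (simp_all add: int_comb_diff left_diff_distrib)

lemma nu_e_nu_star_comb:
  "hecke_nu n * int_comb hecke_e x * hecke_nu_star n = int_comb hecke_e (rho n x)"
  by (induction x rule: frag_induct)
    (simp_all add: rho_frag_of int_comb_sum hecke_nu_e_nu_star int_comb_diff sigma_rho_diff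
      left_diff_distrib right_diff_distrib)

lemma nu_star_e_comb:
  "hecke_nu_star n * int_comb hecke_e x = int_comb hecke_e (sigma n x) * hecke_nu_star n"
  by (induction x rule: frag_induct)
    (simp_all add: sigma_frag_of hecke_nu_star_e int_comb_diff sigma_rho_diff algebra_simps)

lemma e_comb_nu: "int_comb hecke_e x * hecke_nu n = hecke_nu n * int_comb hecke_e (sigma n x)"
  by (induction x rule: frag_induct)
    (simp_all add: sigma_frag_of hecke_e_nu int_comb_diff sigma_rho_diff algebra_simps)

lemma bc_ideal_in_kernel: "x \<in> ideal_generated bc_relators \<Longrightarrow> free_eval hecke_gen x = 0"
proof -
  have one: "int_comb hecke_e 1 = 1"
    using int_comb_frag_of[of hecke_e 0] by (simp add: hecke_e_0)
  have "bc_relators \<subseteq> {x. free_eval hecke_gen x = 0}"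
  proof
    fix x assume "x \<in> bc_relators"
    thus "x \<in> {x. free_eval hecke_gen x = 0}"
      by induction (simp_all add: free_eval_diff free_eval_mult free_eval_add free_eval_gen
          free_eval_one free_eval_of_nat one int_comb_add int_comb_e_mult nu_e_nu_star_comb
          nu_star_e_comb e_comb_nu hecke_nu_mult hecke_nu_star_mult hecke_nu_star_nu
          hecke_nu_nu_star_commute)
  qed
  hence "ideal_generated bc_relators \<subseteq> {x. free_eval hecke_gen x = 0}"
    by (rule ideal_generated_least[OF free_eval_kernel])
  thus "x \<in> ideal_generated bc_relators \<Longrightarrow> free_eval hecke_gen x = 0" by blast
qed

lift_definition bc_to_hecke :: "bc_ring \<Rightarrow> hecke" is "free_eval hecke_gen"
  using bc_ideal_in_kernel by (force simp: free_eval_diff)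

lemma bc_to_hecke_simps:
  "bc_to_hecke (x + y) = bc_to_hecke x + bc_to_hecke y"
  "bc_to_hecke (x - y) = bc_to_hecke x - bc_to_hecke y"
  "bc_to_hecke (x * y) = bc_to_hecke x * bc_to_hecke y"
  "bc_to_hecke 1 = 1"
  by (transfer; simp add: free_eval_add free_eval_diff free_eval_mult free_eval_one)+

lemma bc_to_hecke_gens:
  "bc_to_hecke (bc_emb x) = int_comb hecke_e x"
  "bc_to_hecke (bc_e r) = hecke_e r"
  "bc_to_hecke (bc_mu n) = hecke_nu n"
  "bc_to_hecke (bc_mu_star n) = hecke_nu_star n"
  unfolding bc_e_def by (transfer; simp add: free_eval_gen)+


section \<open>Monomials in normal form\<close>

text \<open>Coprimality makes \<open>n / m\<close> a reduced fraction, so each positive entry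
  \<open>a\<close> belongs to exactly one pair.\<close>

definition coprime_idx :: "(pnat \<times> qmodz \<times> pnat) set" where
  "coprime_idx = {(n, s, m). coprime (nat_of_pnat n) (nat_of_pnat m)}"

definition bc_monomial :: "pnat \<times> qmodz \<times> pnat \<Rightarrow> bc_ring" where
  "bc_monomial = (\<lambda>(n, s, m). bc_mu n * bc_e s * bc_mu_star m)"

definition hecke_monomial :: "pnat \<times> qmodz \<times> pnat \<Rightarrow> hecke" where
  "hecke_monomial = (\<lambda>(n, s, m). hecke_nu n * hecke_e s * hecke_nu_star m)"

lemma bc_to_hecke_comb: "bc_to_hecke (int_comb bc_monomial x) = int_comb hecke_monomial x"
  by (rule int_comb_hom[where S = UNIV])
    (auto simp: bc_to_hecke_simps bc_to_hecke_gens bc_monomial_def hecke_monomial_def)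


section \<open>Coordinates with respect to the Hecke monomials\<close>

text \<open>Duality: the matrix with entries \<open>q / m\<close> and \<open>n / m\<close> lies in
  the support of the monomial with index \<open>(n, abs_qmodz q, m)\<close> and of no other.\<close>

lemma hval_hecke_monomial:
  assumes "(n, r, m) \<in> coprime_idx" "(n', s, m') \<in> coprime_idx"
  shows "hval (hecke_monomial (n', s, m')) (q / qn m) (qn n / qn m) =
    of_bool ((n, abs_qmodz q, m) = (n', s, m'))"
proof -
  obtain q' where q': "s = abs_qmodz q'" using qmodz_abs_surj by blast
  have "hval (hecke_monomial (n', s, m')) (q / qn m) (qn n / qn m) =
      of_bool (qn n / qn m * qn m' = qn n' \<and> q / qn m * qn m' - q' \<in> \<int>)"
    by (simp add: hecke_monomial_def q' hval_mult_nu_star hval_mult_e hval_nu)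
  \<comment> \<open>Equal reduced fractions have equal terms.\<close>
  also have "qn n / qn m * qn m' = qn n' \<longleftrightarrow> n = n' \<and> m = m'"
  proof
    assume "qn n / qn m * qn m' = qn n'"
    hence "qn n * qn m' = qn n' * qn m" by (simp add: field_simps)
    hence eq: "nat_of_pnat n * nat_of_pnat m' = nat_of_pnat n' * nat_of_pnat m"
      by (simp only: of_nat_mult[symmetric] of_nat_eq_iff)
    have "nat_of_pnat n = nat_of_pnat n' \<and> nat_of_pnat m' = nat_of_pnat m"
      using coprime_crossproduct_nat[of "nat_of_pnat n" "nat_of_pnat m" "nat_of_pnat n'" "nat_of_pnat m'"]
        assms eq by (simp add: coprime_idx_def mult_ac)
    thus "n = n' \<and> m = m'" by (simp add: nat_of_pnat_inject)
  qed auto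
  also have "(n = n' \<and> m = m') \<and> q / qn m * qn m' - q' \<in> \<int> \<longleftrightarrow>
      (n, abs_qmodz q, m) = (n', s, m')"
    by (auto simp: q' qmodz.abs_eq_iff)
  finally show ?thesis .
qed

text \<open>Duality extended by linearity. It gives the independence behind injectivity and
  identifies coefficients in \<open>hecke_comb_exhaust\<close>.\<close>

lemma hval_hecke_comb:
  assumes "(n, abs_qmodz q, m) \<in> coprime_idx" "Poly_Mapping.keys x \<subseteq> coprime_idx"
  shows "hval (int_comb hecke_monomial x) (q / qn m) (qn n / qn m) =
    Poly_Mapping.lookup x (n, abs_qmodz q, m)"
  using assms(2)
proof (induction x rule: frag_induction)
  case (one t)
  obtain n' s m' where t: "t = (n', s, m')" by (cases t)
  show ?case using hval_hecke_monomial[OF assms(1), of n' s m' q] one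
    by (auto simp: t lookup_single when_def)
qed (simp_all add: int_comb_diff lookup_minus)

lemma positive_rat_cases:
  assumes "0 < a"
  obtains n m where "coprime (nat_of_pnat n) (nat_of_pnat m)" "a = qn n / qn m"
proof -
  obtain p q where pq: "quotient_of a = (p, q)" by (cases "quotient_of a")
  have q: "0 < q" using quotient_of_denom_pos[OF pq] .
  have a: "a = of_int p / of_int q" using quotient_of_div[OF pq] .
  have p: "0 < p" using assms a q by (simp add: zero_less_divide_iff)
  have "coprime (nat p) (nat q)"
    using quotient_of_coprime[OF pq] p q by (simp add: coprime_int_iff[symmetric])
  moreover have "a = of_nat (nat p) / of_nat (nat q)" using a p q by simp
  ultimately show thesis
    using that[of "pnat_of_nat (nat p)" "pnat_of_nat (nat q)"] p q
    by (simp add: pnat_of_nat_inverse)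
qed

text \<open>By Bezout an integer \<open>z\<close> is \<open>z u n + z v m\<close>, so changing
  \<open>q\<close> by \<open>z\<close> changes \<open>q / m\<close> by
  \<open>z u (n / m) + z v\<close>, which left and right translation absorb.\<close>

lemma hval_cong_mod_Z:
  assumes "coprime (nat_of_pnat n) (nat_of_pnat m)" "abs_qmodz q = abs_qmodz q'"
  shows "hval f (q / qn m) (qn n / qn m) = hval f (q' / qn m) (qn n / qn m)"
proof -
  obtain z where z: "q - q' = of_int z" using assms(2) by (auto simp: qmodz.abs_eq_iff elim: Ints_cases)
  obtain u v where uv: "u * int (nat_of_pnat n) + v * int (nat_of_pnat m) = 1"
    using bezout_int[of "int (nat_of_pnat n)" "int (nat_of_pnat m)"] assms(1) by auto
  have "of_int z = (of_int (z * (u * int (nat_of_pnat n) + v * int (nat_of_pnat m))) :: rat)"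
    by (simp add: uv)
  also have "\<dots> = of_int (z * u) * qn n + of_int (z * v) * qn m"
    by (simp add: algebra_simps)
  finally have "q = q' + of_int (z * u) * qn n + of_int (z * v) * qn m" using z by simp
  hence "q / qn m = q' / qn m + of_int (z * u) * (qn n / qn m) + of_int (z * v)"
    by (simp add: add_divide_distrib)
  thus ?thesis using hval_translate[of "qn n / qn m" f "q' / qn m" "z * u" "z * v"]
    by (simp del: of_int_mult)
qed

lemma coset_support_memI:
  assumes "0 < a" "hval f b a \<noteq> 0"
  shows "PZ #>\<^bsub>PQ\<^esub> pmat b a \<in> coset_support PQ PZ (Rep_hecke f)"
  using assms P.mem_rcoset_self[of "pmat b a"]
  by (auto simp: coset_support_def hval_def pmat_in_PQ)

text \<open>The coefficients are forced to be values of \<open>f\<close> at representatives of the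
  double cosets. That only finitely many are nonzero comes from the finite support of
  \<open>f\<close>.\<close>

lemma hecke_comb_exhaust:
  obtains x where "Poly_Mapping.keys x \<subseteq> coprime_idx" "f = int_comb hecke_monomial x"
proof -
  define c where "c = (\<lambda>(n, s, m). hval f (rep_qmodz s / qn m) (qn n / qn m))"
  define K where "K = {t \<in> coprime_idx. c t \<noteq> 0}"
  have abs_rep: "abs_qmodz (rep_qmodz s) = s" for s
    by (rule Quotient3_abs_rep[OF Quotient3_qmodz])
  \<comment> \<open>\<open>C\<close> maps \<open>K\<close> injectively into the finite support of
    \<open>f\<close>, so \<open>K\<close> is finite.\<close>
  define C where "C = (\<lambda>(n, s, m). PZ #>\<^bsub>PQ\<^esub> pmat (rep_qmodz s / qn m) (qn n / qn m))"
  have "C ` K \<subseteq> coset_support PQ PZ (Rep_hecke f)"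
    by (auto simp: C_def K_def c_def intro!: coset_support_memI)
  moreover have "finite (coset_support PQ PZ (Rep_hecke f))"
    by (rule P.hecke_funsD(4)[OF Rep_hecke])
  moreover have "inj_on C K"
  proof (rule inj_onI)
    fix t t' assume t: "t \<in> K" "t' \<in> K" "C t = C t'"
    obtain n s m n' s' m' where tt: "t = (n, s, m)" "t' = (n', s', m')" by (cases t; cases t')
    have "t \<in> coprime_idx" "t' \<in> coprime_idx" using t by (auto simp: K_def)
    note idx = this[unfolded tt]
    have "pmat (rep_qmodz s / qn m) (qn n / qn m) \<in> C t"
      using P.mem_rcoset_self(1)[of "pmat (rep_qmodz s / qn m) (qn n / qn m)"]
      by (simp add: tt C_def pmat_in_PQ)
    then obtain k where k: "rep_qmodz s / qn m = rep_qmodz s' / qn m' + of_int k * (qn n' / qn m')"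
      "qn n / qn m = qn n' / qn m'"
      unfolding t(3) by (auto simp: tt C_def PZ_rcoset pmat_inject)
    \<comment> \<open>The monomial of \<open>t'\<close> separates: it is 1 at the point of
      \<open>t'\<close>, hence also at the point of \<open>t\<close> in the same coset, and duality
      forces \<open>t = t'\<close>.\<close>
    have "hval (hecke_monomial t') (rep_qmodz s / qn m) (qn n / qn m) =
        hval (hecke_monomial t') (rep_qmodz s' / qn m') (qn n' / qn m')"
      unfolding k using hval_translate[of "qn n' / qn m'" _ "rep_qmodz s' / qn m'" k 0] by simp
    thus "t = t'"
      unfolding tt hval_hecke_monomial[OF idx] hval_hecke_monomial[OF idx(2) idx(2)] abs_rep
      by (simp split: if_splits)
  qed
  ultimately have K: "finite K" using finite_surj[of _ K] finite_imageD finite_subset by metis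
  define x where "x = (\<Sum>t\<in>K. frag_cmul (c t) (frag_of t))"
  have lookup_x: "Poly_Mapping.lookup x t = (if t \<in> K then c t else 0)" for t
    using K by (simp add: x_def lookup_sum lookup_single when_def if_distrib[of "(*) _"] cong: if_cong)
  have keys: "Poly_Mapping.keys x \<subseteq> coprime_idx"
    by (auto simp: in_keys_iff lookup_x K_def split: if_splits)
  have "f = int_comb hecke_monomial x"
  proof (rule hecke_eqI)
    fix b a :: rat assume "0 < a"
    then obtain n m where nm: "coprime (nat_of_pnat n) (nat_of_pnat m)" "a = qn n / qn m"
      using positive_rat_cases by blast
    \<comment> \<open>With this \<open>q\<close>, any point \<open>(b, a)\<close> takes the form
      \<open>(q / m, n / m)\<close> at which coordinates are read.\<close>
    let ?q = "b * qn m"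
    have idx: "(n, abs_qmodz ?q, m) \<in> coprime_idx" using nm by (simp add: coprime_idx_def)
    have "hval (int_comb hecke_monomial x) (?q / qn m) a = c (n, abs_qmodz ?q, m)"
      unfolding nm(2) hval_hecke_comb[OF idx keys] using idx by (simp add: lookup_x K_def)
    also have "\<dots> = hval f (?q / qn m) a"
      unfolding c_def nm(2) by (simp only: prod.case) (rule hval_cong_mod_Z[OF nm(1) abs_rep])
    finally show "hval f b a = hval (int_comb hecke_monomial x) b a" by simp
  qed
  thus thesis using that keys by blast
qed


section \<open>The monomials span the presented ring\<close>

lemma bc_eqI: "x - y \<in> bc_relators \<Longrightarrow> abs_bc_ring x = abs_bc_ring y"
  using ideal_generated(2)[of bc_relators] by (auto simp: bc_ring.abs_eq_iff)

lemma bc_relations: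
  "bc_emb 1 = 1"
  "bc_emb (x + y) = bc_emb x + bc_emb y"
  "bc_emb (x * y) = bc_emb x * bc_emb y"
  "bc_mu n * bc_emb x * bc_mu_star n = bc_emb (rho n x)"
  "bc_mu_star n * bc_emb x = bc_emb (sigma n x) * bc_mu_star n"
  "bc_emb x * bc_mu n = bc_mu n * bc_emb (sigma n x)"
  "bc_mu (n * m) = bc_mu n * bc_mu m"
  "bc_mu_star (n * m) = bc_mu_star n * bc_mu_star m"
  "coprime (nat_of_pnat n) (nat_of_pnat m) \<Longrightarrow> bc_mu n * bc_mu_star m = bc_mu_star m * bc_mu n"
  by (simp_all add: bc_emb_def bc_mu_def bc_mu_star_def times_bc_ring.abs_eq plus_bc_ring.abs_eq
      one_bc_ring_def bc_eqI bc_relators.intros)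

lemma abs_bc_ring_of_nat: "abs_bc_ring (of_nat k) = of_nat k"
  by (induction k) (simp_all add: zero_bc_ring_def one_bc_ring_def plus_bc_ring.abs_eq[symmetric])

lemma bc_mu_star_mu: "bc_mu_star n * bc_mu n = of_nat (nat_of_pnat n)"
  unfolding abs_bc_ring_of_nat[symmetric]
  by (simp add: bc_mu_def bc_mu_star_def times_bc_ring.abs_eq bc_eqI bc_relators.intros)


lemma bc_emb_diff: "bc_emb (x - y) = bc_emb x - bc_emb y"
  using bc_relations(2)[of "x - y" y] by simp

lemma bc_emb_0: "bc_emb 0 = 0"
  using bc_emb_diff[of 0 0] by simp

text \<open>Isolates the common factor removed in \<open>bc_span_mu\<close> and
  \<open>bc_span_mu_star\<close>.\<close>

lemma pnat_gcd_decomposition: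
  obtains g k' m' where "k = g * k'" "m = g * m'" "coprime (nat_of_pnat k') (nat_of_pnat m')"
proof -
  define g where "g = gcd (nat_of_pnat k) (nat_of_pnat m)"
  obtain a b where ab: "nat_of_pnat k = a * g" "nat_of_pnat m = b * g" "coprime a b"
    using gcd_coprime_exists[of "nat_of_pnat k" "nat_of_pnat m"] unfolding g_def by auto
  have "0 < a * g" "0 < b * g" by (simp_all flip: ab(1,2))
  hence "nat_of_pnat (pnat_of_nat g) = g" "nat_of_pnat (pnat_of_nat a) = a"
    "nat_of_pnat (pnat_of_nat b) = b" by (simp_all add: pnat_of_nat_inverse)
  thus thesis
    using that[of "pnat_of_nat g" "pnat_of_nat a" "pnat_of_nat b"] ab
    by (simp add: nat_of_pnat_inject[symmetric] times_pnat.rep_eq mult.commute)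
qed

definition bc_span :: "bc_ring set" where
  "bc_span = int_comb bc_monomial ` {x. Poly_Mapping.keys x \<subseteq> coprime_idx}"

lemma bc_span_diff: "y \<in> bc_span \<Longrightarrow> z \<in> bc_span \<Longrightarrow> y - z \<in> bc_span"
proof -
  assume "y \<in> bc_span" "z \<in> bc_span"
  then obtain u v where "y = int_comb bc_monomial u" "z = int_comb bc_monomial v"
    "Poly_Mapping.keys u \<subseteq> coprime_idx" "Poly_Mapping.keys v \<subseteq> coprime_idx"
    by (auto simp: bc_span_def)
  moreover have "Poly_Mapping.keys (u - v) \<subseteq> Poly_Mapping.keys u \<union> Poly_Mapping.keys v"
    by (rule keys_diff)
  ultimately show ?thesis
    unfolding bc_span_def by (intro image_eqI[of _ _ "u - v"]) (auto simp: int_comb_diff)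
qed

lemma bc_span_0: "0 \<in> bc_span"
  unfolding bc_span_def by (rule image_eqI[of _ _ 0]) simp_all

lemma bc_span_of_nat_mult: "z \<in> bc_span \<Longrightarrow> of_nat k * z \<in> bc_span"
proof (induction k)
  case (Suc k)
  \<comment> \<open>Adding \<open>z\<close> is done as subtracting \<open>0 - z\<close>.\<close>
  thus ?case using bc_span_diff[of "of_nat k * z" "0 - z"] bc_span_diff[OF bc_span_0]
    by (simp add: algebra_simps)
qed (simp add: bc_span_0)

text \<open>Linear in \<open>x\<close>. A general \<open>x\<close> is allowed because the rewriting
  below leaves products and values of \<open>rho\<close> in the middle.\<close>

lemma bc_span_normal_form:
  assumes "coprime (nat_of_pnat n) (nat_of_pnat m)"
  shows "bc_mu n * bc_emb x * bc_mu_star m \<in> bc_span"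
proof (induction x rule: frag_induct)
  case (single s)
  show ?case unfolding bc_span_def
    by (rule image_eqI[of _ _ "frag_of (n, s, m)"])
      (use assms in \<open>simp_all add: bc_monomial_def bc_e_def coprime_idx_def\<close>)
qed (simp_all add: bc_emb_0 bc_emb_diff bc_span_0 bc_span_diff left_diff_distrib right_diff_distrib)

lemma bc_span_left_mult:
  assumes "z \<in> bc_span"
    "\<And>n s m. coprime (nat_of_pnat n) (nat_of_pnat m) \<Longrightarrow>
      c * (bc_mu n * bc_emb (frag_of s) * bc_mu_star m) \<in> bc_span"
  shows "c * z \<in> bc_span"
proof -
  obtain x where x: "z = int_comb bc_monomial x" "Poly_Mapping.keys x \<subseteq> coprime_idx"
    using assms(1) by (auto simp: bc_span_def)
  show ?thesis unfolding x(1) using x(2)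
  proof (induction x rule: frag_induction)
    case (one t)
    thus ?case using assms(2) by (cases t) (simp add: bc_monomial_def coprime_idx_def bc_e_def)
  qed (simp_all add: bc_span_0 bc_span_diff int_comb_diff right_diff_distrib)
qed

text \<open>\<open>bc_emb x\<close> passes \<open>bc_mu n\<close> as \<open>sigma n x\<close> and
  merges with the middle factor.\<close>

lemma bc_span_emb: "z \<in> bc_span \<Longrightarrow> bc_emb x * z \<in> bc_span"
proof (erule bc_span_left_mult)
  fix n s m assume "coprime (nat_of_pnat n) (nat_of_pnat m)"
  have "bc_emb x * (bc_mu n * bc_emb (frag_of s) * bc_mu_star m) =
      (bc_emb x * bc_mu n) * bc_emb (frag_of s) * bc_mu_star m" by (simp only: mult.assoc)
  also have "\<dots> = bc_mu n * bc_emb (sigma n x * frag_of s) * bc_mu_star m"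
    by (simp only: bc_relations mult.assoc)
  finally show "bc_emb x * (bc_mu n * bc_emb (frag_of s) * bc_mu_star m) \<in> bc_span"
    using bc_span_normal_form[OF \<open>coprime _ _\<close>] by simp
qed

text \<open>\<open>k n\<close> may share a factor \<open>g\<close> with \<open>m\<close>. Splitting
  as \<open>n' g\<close> and \<open>g m'\<close> puts \<open>bc_mu g\<close> and
  \<open>bc_mu_star g\<close> on the two sides of the middle factor, where they collapse to
  \<open>rho g\<close>.\<close>

lemma bc_span_mu: "z \<in> bc_span \<Longrightarrow> bc_mu k * z \<in> bc_span"
proof (erule bc_span_left_mult)
  fix n s m
  obtain g n' m' where g: "k * n = g * n'" "m = g * m'" "coprime (nat_of_pnat n') (nat_of_pnat m')"
    using pnat_gcd_decomposition by blast
  have "bc_mu k * (bc_mu n * bc_emb (frag_of s) * bc_mu_star m) =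
      bc_mu (n' * g) * bc_emb (frag_of s) * bc_mu_star (g * m')"
    unfolding g(2) mult.commute[of n' g] g(1)[symmetric] by (simp only: bc_relations mult.assoc)
  also have "\<dots> = bc_mu n' * (bc_mu g * bc_emb (frag_of s) * bc_mu_star g) * bc_mu_star m'"
    by (simp only: bc_relations(7,8) mult.assoc)
  also have "\<dots> = bc_mu n' * bc_emb (rho g (frag_of s)) * bc_mu_star m'"
    by (simp only: bc_relations(4))
  finally show "bc_mu k * (bc_mu n * bc_emb (frag_of s) * bc_mu_star m) \<in> bc_span"
    using bc_span_normal_form[OF g(3)] by simp
qed

text \<open>The common factor \<open>g\<close> of \<open>k\<close> and \<open>n\<close> becomes the
  integer \<open>g\<close>. The coprime remainders commute, and \<open>bc_mu_star k'\<close> then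
  passes the middle factor through \<open>sigma k'\<close> and joins
  \<open>bc_mu_star m\<close>.\<close>

lemma bc_span_mu_star: "z \<in> bc_span \<Longrightarrow> bc_mu_star k * z \<in> bc_span"
proof (erule bc_span_left_mult)
  fix n s m assume nm: "coprime (nat_of_pnat n) (nat_of_pnat m)"
  obtain g k' n' where g: "k = g * k'" "n = g * n'" "coprime (nat_of_pnat k') (nat_of_pnat n')"
    using pnat_gcd_decomposition by blast
  \<comment> \<open>\<open>n'\<close> divides \<open>n\<close>, hence is prime to \<open>m\<close>,
    and it is prime to \<open>k'\<close> by the choice of \<open>g\<close>.\<close>
  have co: "coprime (nat_of_pnat n') (nat_of_pnat k')" "coprime (nat_of_pnat n') (nat_of_pnat (k' * m))"
    using nm g by (simp_all add: times_pnat.rep_eq coprime_commute)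
  have "bc_mu_star k * (bc_mu n * bc_emb (frag_of s) * bc_mu_star m) =
      bc_mu_star (k' * g) * bc_mu (g * n') * bc_emb (frag_of s) * bc_mu_star m"
    unfolding g(1,2) by (simp only: mult.assoc mult.commute[of k' g])
  also have "\<dots> = bc_mu_star k' * (bc_mu_star g * bc_mu g) * bc_mu n' * bc_emb (frag_of s) * bc_mu_star m"
    by (simp only: bc_relations(7,8) mult.assoc)
  also have "\<dots> = of_nat (nat_of_pnat g) *
      ((bc_mu_star k' * bc_mu n') * bc_emb (frag_of s) * bc_mu_star m)"
    unfolding bc_mu_star_mu mult_of_nat_commute[symmetric] by (simp only: mult.assoc)
  also have "(bc_mu_star k' * bc_mu n') * bc_emb (frag_of s) * bc_mu_star m =
      bc_mu n' * (bc_mu_star k' * bc_emb (frag_of s)) * bc_mu_star m"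
    by (simp only: bc_relations(9)[OF co(1), symmetric] mult.assoc)
  also have "\<dots> = bc_mu n' * bc_emb (sigma k' (frag_of s)) * bc_mu_star (k' * m)"
    by (simp only: bc_relations(5,8) mult.assoc)
  finally show "bc_mu_star k * (bc_mu n * bc_emb (frag_of s) * bc_mu_star m) \<in> bc_span"
    using bc_span_of_nat_mult[OF bc_span_normal_form[OF co(2)]] by simp
qed

text \<open>No relation says so directly: \<open>\<mu>\<^sub>1\<close> and \<open>\<mu>\<^sub>1\<^sup>*\<close> are mutually inverse idempotents.\<close>

lemma bc_mu_1: "bc_mu 1 = 1" and bc_mu_star_1: "bc_mu_star 1 = 1"
proof -
  have "qmodz_scale 1 s = s" for s by transfer simp
  hence "rho 1 1 = 1" using rho_frag_of[of 1 0] by (simp add: one_pnat.rep_eq)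
  hence inv: "bc_mu 1 * bc_mu_star 1 = 1"
    using bc_relations(4)[of 1 1] by (simp add: bc_relations(1))
  have "bc_mu 1 * (bc_mu 1 * bc_mu_star 1) = (bc_mu 1 * bc_mu 1) * bc_mu_star 1"
    by (simp only: mult.assoc)
  also have "\<dots> = bc_mu 1 * bc_mu_star 1" using bc_relations(7)[of 1 1] by simp
  finally show "bc_mu 1 = 1" by (simp add: inv)
  thus "bc_mu_star 1 = 1" using inv by simp
qed

text \<open>The span contains \<open>1\<close> and is stable under left multiplication by
  generators, so it contains every word, by induction on the word, and then all integral
  combinations.\<close>

lemma bc_span_UNIV: "z \<in> bc_span"
proof (induction z rule: bc_ring.abs_induct)
  case (1 w)
  show ?case
  proof (induction w rule: frag_induct)
    case zero
    show ?case using bc_span_0 by (simp add: zero_bc_ring_def)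
  next
    case (diff u v)
    thus ?case using bc_span_diff by (simp add: minus_bc_ring.abs_eq[symmetric])
  next
    case (single l)
    have "abs_bc_ring (frag_of (Letters gs)) \<in> bc_span" for gs
    proof (induction gs)
      case Nil
      have "abs_bc_ring (frag_of (Letters [])) = 1"
        by (simp add: one_bc_ring_def zero_free_monoid_def[symmetric])
      \<comment> \<open>The empty word is the monomial with \<open>n = m = 1\<close> and the unit in
        the middle.\<close>
      thus ?case using bc_span_normal_form[of 1 1 1]
        by (simp add: bc_mu_1 bc_mu_star_1 bc_relations one_pnat.rep_eq)
    next
      case (Cons g gs)
      have "frag_of (Letters (g # gs)) = gen g * frag_of (Letters gs)"
        by (simp add: gen_def frag_of_mult plus_free_monoid_def)
      hence "abs_bc_ring (frag_of (Letters (g # gs))) =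
          abs_bc_ring (gen g) * abs_bc_ring (frag_of (Letters gs))"
        by (simp add: times_bc_ring.abs_eq)
      thus ?case
        using bc_span_emb[OF Cons] bc_span_mu[OF Cons] bc_span_mu_star[OF Cons]
        by (cases g) (simp_all add: bc_emb_def bc_mu_def bc_mu_star_def)
    qed
    thus ?case by (cases l) simp
  qed
qed

section \<open>The isomorphism and its uniqueness\<close>

text \<open>A kernel element is a combination of normal monomials, and the coordinates of its image
  are its coefficients, which therefore vanish.\<close>

lemma bc_to_hecke_bij: "bij bc_to_hecke"
proof (rule bijI)
  have ker: "z = 0" if "bc_to_hecke z = 0" for z
  proof -
    obtain x where x: "z = int_comb bc_monomial x" "Poly_Mapping.keys x \<subseteq> coprime_idx"
      using bc_span_UNIV[of z] by (auto simp: bc_span_def)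
    have z: "int_comb hecke_monomial x = 0" using that by (simp add: x(1) bc_to_hecke_comb)
    have "Poly_Mapping.lookup x (n, s, m) = 0" for n s m
    proof (cases "(n, s, m) \<in> coprime_idx")
      case True
      obtain q where "s = abs_qmodz q" using qmodz_abs_surj by blast
      thus ?thesis using hval_hecke_comb[of n q m x] True x(2) z by simp
    qed (use x(2) in \<open>auto simp: in_keys_iff\<close>)
    hence "x = 0" by (intro poly_mapping_eqI) auto
    thus ?thesis by (simp add: x(1))
  qed
  show "inj bc_to_hecke"
  proof (rule injI)
    fix y z assume "bc_to_hecke y = bc_to_hecke z"
    thus "y = z" using ker[of "y - z"] by (simp add: bc_to_hecke_simps)
  qed
  show "surj bc_to_hecke"
    unfolding surj_def
  proof
    fix f
    obtain x where "f = int_comb hecke_monomial x" using hecke_comb_exhaust by blast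
    thus "\<exists>z. f = bc_to_hecke z" by (simp add: bc_to_hecke_comb[symmetric]) blast
  qed
qed

lemma ring_isomorphism_inv:
  assumes "ring_isomorphism \<psi>"
  shows "ring_isomorphism (inv_into UNIV \<psi>)"
proof -
  have b: "bij \<psi>" using assms by (simp add: ring_isomorphism_def)
  have "inv_into UNIV \<psi> x = y \<longleftrightarrow> x = \<psi> y" for x y
    using b by (auto simp: bij_is_inj bij_is_surj surj_f_inv_f)
  thus ?thesis
    using assms b bij_imp_bij_inv[OF b] by (simp add: ring_isomorphism_def bij_is_surj surj_f_inv_f)
qed

theorem proposition4p13:
  shows "\<exists>!\<phi> :: hecke \<Rightarrow> bc_ring.
    ring_isomorphism \<phi> \<and>
    (\<forall>r. \<phi> (hecke_e r) = bc_e r) \<and>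
    (\<forall>n. \<phi> (hecke_nu n) = bc_mu n \<and> \<phi> (hecke_nu_star n) = bc_mu_star n)"
proof (rule ex1I)
  have "ring_isomorphism bc_to_hecke"
    by (simp add: ring_isomorphism_def bc_to_hecke_bij bc_to_hecke_simps)
  moreover have "inv_into UNIV bc_to_hecke (bc_to_hecke z) = z" for z
    using bc_to_hecke_bij by (simp add: bij_is_inj)
  ultimately show "ring_isomorphism (inv_into UNIV bc_to_hecke) \<and>
      (\<forall>r. inv_into UNIV bc_to_hecke (hecke_e r) = bc_e r) \<and>
      (\<forall>n. inv_into UNIV bc_to_hecke (hecke_nu n) = bc_mu n \<and> inv_into UNIV bc_to_hecke (hecke_nu_star n) = bc_mu_star n)"
    using ring_isomorphism_inv by (metis bc_to_hecke_gens(2-4))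
next
  fix \<phi> :: "hecke \<Rightarrow> bc_ring"
  assume \<phi>: "ring_isomorphism \<phi> \<and> (\<forall>r. \<phi> (hecke_e r) = bc_e r) \<and>
    (\<forall>n. \<phi> (hecke_nu n) = bc_mu n \<and> \<phi> (hecke_nu_star n) = bc_mu_star n)"
  hence hom: "\<phi> (x + y) = \<phi> x + \<phi> y" "\<phi> (x * y) = \<phi> x * \<phi> y" for x y
    by (simp_all add: ring_isomorphism_def)
  have diff: "\<phi> (x - y) = \<phi> x - \<phi> y" for x y
    using hom(1)[of "x - y" y] by simp
  \<comment> \<open>Monomials are products of generators, so their images are prescribed; as they
    span the Hecke algebra, this determines \<phi>.\<close>
  have comb: "\<phi> (int_comb hecke_monomial x) = int_comb bc_monomial x" for x
    by (rule int_comb_hom[where S = UNIV])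
      (use \<phi> in \<open>auto simp: diff hom bc_monomial_def hecke_monomial_def\<close>)
  show "\<phi> = inv_into UNIV bc_to_hecke"
  proof
    fix f
    obtain x where "f = int_comb hecke_monomial x" using hecke_comb_exhaust by blast
    thus "\<phi> f = inv_into UNIV bc_to_hecke f"
      using bc_to_hecke_bij by (simp add: comb) (simp add: bc_to_hecke_comb[symmetric] bij_is_inj)
  qed
qed

end
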